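(* Let $G$ be a profinite group and $p$ a prime. Then the following are equivalent: \begin{enumerate} \item $G$ is $p$-positive; \item $G$ is $p$-uniformly-positive; \item $P_p(G,G) > 0$; \item $G$ is virtually pro-$p$; \item $\mu\left(\bigcap_{g \in \Omega_p(G)}\Omega_p(g,G)\right) = |G:O_p(G)|^{-1} > 0$. \end{enumerate}
   Context: Let $G$ be a profinite group with normalized Haar measure $\mu$, and $p$ a prime. An element $g\in G$ is a $p$-element if $\langle g\rangle N/N$ is a finite $p$-group for every open normal subgroup $N$ of $G$; $\Omega_p(G)$ is the set of $p$-elements of $G$. For $x,g\in G$, $\langle x,g\rangle$ denotes the smallest closed subgroup of $G$ containing $x$ and $g$. Set $\Omega_p(g,G)=\{x\in G : \langle x,g\rangle \text{ is a pro-}p\text{ group}\}$ (a closed subset of $G$) and $P_p(g,G)=\mu(\Omega_p(g,G))$. $G$ is $p$-positive if $P_p(g,G)>0$ for every $p$-element $g$ of $G$; $G$ is $p$-uniformly-positive if there exists a real number $c>0$ such that $P_p(g,G)>c$ for every $p$-element $g$ of $G$. $P_p(G,G)$ is the probability (with respect to the product Haar measure on $G\times G$) that two randomly chosen elements of $G$ topologically generate a pro-$p$ subgroup. $O_p(G)$ is the largest normal pro-$p$ subgroup of $G$. $G$ is virtually pro-$p$ if it contains an open pro-$p$ subgroup. *)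

theory Defs
  imports "HOL-Algebra.Algebra" "HOL-Probability.Probability"
begin

section \<open>Profinite and pro-p groups\<close>

locale topological_group = group G for G (structure) +
  fixes T :: "'a topology"
  assumes topspace_eq_carrier: "topspace T = carrier G"
    and continuous_mult: "continuous_map (prod_topology T T) T (\<lambda>(x, y). x \<otimes> y)"
    and continuous_inv: "continuous_map T T (\<lambda>x. inv x)"

locale profinite_group = topological_group +
  assumes compact: "compact_space T"
    and Hausdorff: "Hausdorff_space T"
    and totally_disconnected:
      "\<And>x y. x \<in> topspace T \<Longrightarrow> connected_component_of T x y \<Longrightarrow> x = y"

definition finite_p_group :: "('a, 'b) monoid_scheme \<Rightarrow> nat \<Rightarrow> bool" where
  "finite_p_group G p \<longleftrightarrow> group G \<and> finite (carrier G) \<and> (\<exists>n. card (carrier G) = p ^ n)"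

definition pro_p_group :: "('a, 'b) monoid_scheme \<Rightarrow> 'a topology \<Rightarrow> nat \<Rightarrow> bool" where
  "pro_p_group G T p \<longleftrightarrow> profinite_group G T \<and>
     (\<forall>N. N \<lhd> G \<and> openin T N \<longrightarrow> finite_p_group (G Mod N) p)"

text \<open>A subgroup carries the subspace topology. A pro-p subgroup is compact, hence closed.\<close>

definition pro_p_subgroup :: "'a set \<Rightarrow> ('a, 'b) monoid_scheme \<Rightarrow> 'a topology \<Rightarrow> nat \<Rightarrow> bool" where
  "pro_p_subgroup H G T p \<longleftrightarrow>
     subgroup H G \<and> pro_p_group (G\<lparr>carrier := H\<rparr>) (subtopology T H) p"

definition top_generate :: "('a, 'b) monoid_scheme \<Rightarrow> 'a topology \<Rightarrow> 'a set \<Rightarrow> 'a set" where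
  "top_generate G T S = (\<lambda>H. subgroup H G \<and> closedin T H) hull S"

definition p_core :: "('a, 'b) monoid_scheme \<Rightarrow> 'a topology \<Rightarrow> nat \<Rightarrow> 'a set" where
  "p_core G T p = (GREATEST K. K \<lhd> G \<and> pro_p_subgroup K G T p)"

definition virtually_pro_p :: "('a, 'b) monoid_scheme \<Rightarrow> 'a topology \<Rightarrow> nat \<Rightarrow> bool" where
  "virtually_pro_p G T p \<longleftrightarrow> (\<exists>H. openin T H \<and> pro_p_subgroup H G T p)"

text \<open>The carrier below is the image of the closed subgroup generated by \<open>g\<close> in \<open>G Mod N\<close>.
  As \<open>N\<close> is open, it is also the image of the abstract subgroup generated by \<open>g\<close>.\<close>

definition p_element :: "('a, 'b) monoid_scheme \<Rightarrow> 'a topology \<Rightarrow> nat \<Rightarrow> 'a \<Rightarrow> bool" where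
  "p_element G T p g \<longleftrightarrow> g \<in> carrier G \<and>
     (\<forall>N. N \<lhd> G \<and> openin T N \<longrightarrow>
        finite_p_group ((G Mod N)\<lparr>carrier := (\<lambda>x. N #>\<^bsub>G\<^esub> x) ` top_generate G T {g}\<rparr>) p)"

definition p_elements :: "('a, 'b) monoid_scheme \<Rightarrow> 'a topology \<Rightarrow> nat \<Rightarrow> 'a set" where
  "p_elements G T p = {g. p_element G T p g}"

section \<open>Haar measure\<close>

text \<open>Outside the second countable case the Haar measure is pinned down by its invariance
  only among regular Borel measures.\<close>

definition regular_borel_measure :: "'a topology \<Rightarrow> 'a measure \<Rightarrow> bool" where
  "regular_borel_measure T M \<longleftrightarrow>
     sets M = sets (sigma (topspace T) {U. openin T U}) \<and>
     (\<forall>A\<in>sets M. emeasure M A = (INF U\<in>{U. openin T U \<and> A \<subseteq> U}. emeasure M U))"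

definition normalized_haar ::
    "('a, 'b) monoid_scheme \<Rightarrow> 'a topology \<Rightarrow> 'a measure \<Rightarrow> bool" where
  "normalized_haar G T \<mu> \<longleftrightarrow> regular_borel_measure T \<mu> \<and> prob_space \<mu> \<and>
     (\<forall>x\<in>carrier G. \<forall>A\<in>sets \<mu>. emeasure \<mu> (x <#\<^bsub>G\<^esub> A) = emeasure \<mu> A)"

text \<open>The product as regular Borel measures. It extends \<open>\<mu> \<Otimes>\<^sub>M \<mu>\<close>, whose sigma-algebra need
  not contain every closed subset of the product space if the topology is not second countable.\<close>

definition regular_product :: "'a topology \<Rightarrow> 'a measure \<Rightarrow> ('a \<times> 'a) measure \<Rightarrow> bool" where
  "regular_product T \<mu> \<nu> \<longleftrightarrow> regular_borel_measure (prod_topology T T) \<nu> \<and>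
     (\<forall>A\<in>sets \<mu>. \<forall>B\<in>sets \<mu>. emeasure \<nu> (A \<times> B) = emeasure \<mu> A * emeasure \<mu> B)"

section \<open>Probability of generating a pro-p subgroup\<close>

definition Omega_at :: "('a, 'b) monoid_scheme \<Rightarrow> 'a topology \<Rightarrow> nat \<Rightarrow> 'a \<Rightarrow> 'a set" where
  "Omega_at G T p g = {x \<in> carrier G. pro_p_subgroup (top_generate G T {x, g}) G T p}"

definition P_at ::
    "('a, 'b) monoid_scheme \<Rightarrow> 'a topology \<Rightarrow> 'a measure \<Rightarrow> nat \<Rightarrow> 'a \<Rightarrow> real" where
  "P_at G T \<mu> p g = measure \<mu> (Omega_at G T p g)"

definition P_pair ::
    "('a, 'b) monoid_scheme \<Rightarrow> 'a topology \<Rightarrow> ('a \<times> 'a) measure \<Rightarrow> nat \<Rightarrow> real" where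
  "P_pair G T \<nu> p = measure \<nu> {(x, y). x \<in> carrier G \<and> y \<in> carrier G \<and>
     pro_p_subgroup (top_generate G T {x, y}) G T p}"

definition p_positive ::
    "('a, 'b) monoid_scheme \<Rightarrow> 'a topology \<Rightarrow> 'a measure \<Rightarrow> nat \<Rightarrow> bool" where
  "p_positive G T \<mu> p \<longleftrightarrow> (\<forall>g\<in>p_elements G T p. P_at G T \<mu> p g > 0)"

definition p_uniformly_positive ::
    "('a, 'b) monoid_scheme \<Rightarrow> 'a topology \<Rightarrow> 'a measure \<Rightarrow> nat \<Rightarrow> bool" where
  "p_uniformly_positive G T \<mu> p \<longleftrightarrow>
     (\<exists>c>0. \<forall>g\<in>p_elements G T p. P_at G T \<mu> p g > c)"

text \<open>The value is 0 if the index is infinite.\<close>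

definition inverse_index :: "('a, 'b) monoid_scheme \<Rightarrow> 'a set \<Rightarrow> real" where
  "inverse_index G H = inverse (real (card (rcosets\<^bsub>G\<^esub> H)))"

end

theory Submission
  imports Defs
begin

text \<open>Everything is decided in the finite quotients \<open>F = G Mod N\<close> by open normal subgroups \<open>N\<close>. These form
a neighbourhood basis of \<open>\<one>\<close> (\<open>open_normal_basis\<close>), so a closed subgroup is pro-p exactly when all its
images are p-groups (\<open>pro_p_subgroup_iff\<close>), and the relevant subsets of \<open>G\<close> and \<open>G \<times> G\<close> are
intersections of clopen sets pulled back from the quotients, with measures obtained by counting.

A positive proportion of p-pairs makes \<open>G\<close> virtually pro-p. Let \<open>F\<close> have order \<open>p ^ a * m\<close> with \<open>m\<close> prime
to \<open>p\<close>, and let \<open>P\<close> be a Sylow p-subgroup. A p-subgroup acting on the \<open>m\<close> cosets of \<open>P\<close> fixes one of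
them, hence lies in one of at most \<open>m\<close> conjugates of \<open>P\<close>. So at most \<open>m * (p ^ a)\<^sup>2\<close> pairs generate a
p-group, which is the fraction \<open>1 / m\<close> of all pairs (\<open>card_p_generating_pairs_le\<close>). If this fraction is at
least \<open>c > 0\<close> in every quotient, then \<open>m \<le> 1 / c\<close> throughout. An \<open>N\<close> for which \<open>m\<close> is maximal is pro-p,
because \<open>card (G Mod M)\<close> for smaller \<open>M\<close> can only gain powers of \<open>p\<close> (\<open>virtually_pro_p_if_many_p_pairs\<close>).

Such a \<open>c\<close> exists if two random elements generate a pro-p subgroup with positive probability. It also
exists if \<open>G\<close> is p-positive: the p-elements are the members of \<open>Omega_at G T p \<one>\<close>, hence have positive
measure, and they are covered by countably many closed sets \<open>E n\<close> of elements \<open>h\<close> such that, in every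
quotient, at least the fraction \<open>1 / (n + 1)\<close> of elements generates a p-group together with \<open>h\<close>. Some
\<open>E n\<close> has positive measure, and a double count gives \<open>c = \<mu> (E n) / (n + 1)\<close>
(\<open>virtually_pro_p_if_p_positive\<close>).

Conversely, let \<open>X\<close> be the set of the elements that generate a pro-p subgroup together with every
p-element. For every profinite \<open>G\<close> it equals the largest normal pro-p subgroup
(\<open>p_core_eq_p_joint_set\<close>). A normal pro-p subgroup times a p-subgroup is a p-group in every quotient, so
it lies in \<open>X\<close>. In the other direction \<open>X\<close> is closed under conjugation and any two members of \<open>X\<close>
generate a p-group in each quotient, so the image of \<open>X\<close> generates a p-group by the theorem of Baer and
Suzuki. If \<open>G\<close> is virtually pro-p, then \<open>X\<close> is open. Its measure is therefore the inverse of its index, it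
bounds all the probabilities \<open>P_at G T \<mu> p g\<close> from below, and \<open>X \<times> X\<close> consists of pairs that generate a
pro-p subgroup.\<close>

section \<open>Finite p-groups\<close>

text \<open>The image of a closed subgroup in a finite quotient is only a set of cosets, so "p-group" is expressed by
the number of elements alone. For a prime \<open>p\<close> an infinite set is never \<open>p_sized\<close>, since its cardinality
counts as 0.\<close>

definition p_sized :: "nat \<Rightarrow> 'a set \<Rightarrow> bool" where
  "p_sized p S \<longleftrightarrow> (\<exists>n. card S = p ^ n)"

lemma (in group) inv_mult_cancel_left:
  assumes "x \<in> carrier G" "y \<in> carrier G"
  shows "inv x \<otimes> (x \<otimes> y) = y" "x \<otimes> (inv x \<otimes> y) = y"
  using assms by (simp_all flip: m_assoc)

text \<open>Cauchy's theorem: a prime \<open>q\<close> dividing \<open>card H\<close> gives a subgroup of order \<open>q\<close>, hence an element whose order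
is both \<open>q\<close> and a power of \<open>p\<close>. The elementwise form makes it immediate that subgroups, images and
extensions of p-groups are p-groups.\<close>

lemma (in group) p_sized_iff_elements:
  assumes "finite (carrier G)" "Factorial_Ring.prime p" "subgroup H G"
  shows "p_sized p H \<longleftrightarrow> (\<forall>x\<in>H. \<exists>n::nat. x [^] (p ^ n) = \<one>)"
proof
  interpret H: group "G\<lparr>carrier := H\<rparr>" using assms(3) by (rule subgroup_imp_group)
  assume "p_sized p H"
  then obtain n where n: "card H = p ^ n" unfolding p_sized_def by blast
  show "\<forall>x\<in>H. \<exists>n::nat. x [^] (p ^ n) = \<one>"
  proof
    fix x assume "x \<in> H"
    then have "x [^]\<^bsub>G\<lparr>carrier := H\<rparr>\<^esub> (card H) = \<one>"
      using H.pow_order_eq_1[of x] by (simp add: Coset.order_def)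
    then show "\<exists>n::nat. x [^] (p ^ n) = \<one>" using n nat_pow_consistent by metis
  qed
next
  interpret H: group "G\<lparr>carrier := H\<rparr>" using assms(3) by (rule subgroup_imp_group)
  assume el: "\<forall>x\<in>H. \<exists>n::nat. x [^] (p ^ n) = \<one>"
  have finH: "finite H" using assms(1,3) finite_subset subgroup.subset by blast
  have cpos: "card H > 0" using finH subgroup.one_closed[OF assms(3)] card_gt_0_iff by blast
  have only: "q = p" if q: "Factorial_Ring.prime q" "q dvd card H" for q :: nat
  proof -
    obtain m where m: "card H = q ^ 1 * m" using q(2) by auto
    then obtain K where K: "subgroup K (G\<lparr>carrier := H\<rparr>)" "card K = q ^ 1"
      using sylow_thm[OF q(1) H.is_group, of 1 m] finH by (auto simp: Coset.order_def)
    interpret K: subgroup K "G\<lparr>carrier := H\<rparr>" by fact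
    interpret KG: group "G\<lparr>carrier := K\<rparr>"
      using subgroup_imp_group[OF incl_subgroup[OF assms(3) K(1)]] .
    \<comment> \<open>An element of prime order \<open>q\<close>, found in a subgroup of order \<open>q\<close>.\<close>
    have "card K > 1" using K(2) q(1) prime_gt_1_nat by simp
    then have "\<not> K \<subseteq> {\<one>}" using card_mono[of "{\<one>}" K] by fastforce
    then obtain x where x: "x \<in> K" "x \<noteq> \<one>" by blast
    obtain n :: nat where n: "x [^] (p ^ n) = \<one>" using el x(1) K.subset by auto
    have xG: "x \<in> carrier G" using x(1) K.subset subgroup.subset[OF assms(3)] by auto
    have "x [^]\<^bsub>G\<lparr>carrier := K\<rparr>\<^esub> (card K) = \<one>"
      using KG.pow_order_eq_1[of x] x(1) by (simp add: Coset.order_def)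
    then have "x [^] (card K) = \<one>" using nat_pow_consistent by metis
    then have "ord x dvd q" using K(2) pow_eq_id[OF xG] by simp
    moreover have "ord x dvd p ^ n" using n pow_eq_id[OF xG] by simp
    moreover have "ord x \<noteq> 1" using x(2) ord_eq_1[OF xG] by simp
    ultimately have "ord x = q" "q dvd p ^ n" using q(1) prime_nat_iff by metis+
    then show "q = p" using q(1) assms(2) prime_dvd_power_nat primes_dvd_imp_eq by blast
  qed
  have "\<exists>n. card H = p ^ n"
  proof (cases "card H = 1")
    case True then show ?thesis by (intro exI[of _ 0]) simp
  next
    case False
    have "prime_factors (card H) \<subseteq> {p}" using only by (auto simp: in_prime_factors_iff)
    then have "set_mset (prime_factorization (card H)) \<subseteq> {p}" .
    then obtain n where "prime_factorization (card H) = replicate_mset n p"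
      using set_mset_subset_singletonD by metis
    then have "card H = p ^ n"
      using prod_mset_prime_factorization_nat[of "card H"] cpos by simp
    then show ?thesis by blast
  qed
  then show "p_sized p H" unfolding p_sized_def .
qed

lemma (in group) p_sized_subgroup:
  assumes "finite (carrier G)" "Factorial_Ring.prime p" "subgroup H G" "subgroup K G" "K \<subseteq> H"
    "p_sized p H"
  shows "p_sized p K"
  using assms p_sized_iff_elements by blast

lemma (in group) pow_mult_normalized:
  assumes "subgroup H G" "l \<in> carrier G" "h \<in> H"
    and norm: "\<And>n h. h \<in> H \<Longrightarrow> l [^] (n::nat) \<otimes> h \<otimes> inv (l [^] n) \<in> H"
  shows "\<exists>h'\<in>H. (h \<otimes> l) [^] (n::nat) = h' \<otimes> l [^] n"
proof (induction n)
  case 0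
  then show ?case using subgroup.one_closed[OF assms(1)] by (intro bexI[of _ "\<one>"]) auto
next
  case (Suc n)
  then obtain h' where h': "h' \<in> H" "(h \<otimes> l) [^] n = h' \<otimes> l [^] n" by blast
  have c: "h \<in> carrier G" "h' \<in> carrier G"
    using h'(1) assms(1,3) subgroup.mem_carrier by metis+
  let ?k = "l [^] n \<otimes> h \<otimes> inv (l [^] n)"
  have k: "?k \<in> H" using norm assms(3) .
  have "(h \<otimes> l) [^] (Suc n) = h' \<otimes> l [^] n \<otimes> (h \<otimes> l)" using h' by simp
  also have "\<dots> = h' \<otimes> ?k \<otimes> (l [^] Suc n)"
    using c assms(2) by (simp add: m_assoc inv_mult_cancel_left)
  finally show ?case using k h'(1) subgroup.m_closed[OF assms(1)] by metis
qed

text \<open>The subgroup is the product \<open>H <#> L\<close>: some p-power of \<open>h \<otimes> l\<close> cancels \<open>l\<close> and therefore lies in \<open>H\<close>.\<close>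

lemma (in group) p_sized_join:
  assumes fin: "finite (carrier G)" and p: "Factorial_Ring.prime p"
    and H: "subgroup H G" "p_sized p H" and L: "subgroup L G" "p_sized p L"
    and norm: "\<And>l h. l \<in> L \<Longrightarrow> h \<in> H \<Longrightarrow> l \<otimes> h \<otimes> inv l \<in> H"
  shows "\<exists>R. subgroup R G \<and> p_sized p R \<and> H \<union> L \<subseteq> R"
proof -
  let ?R = "H <#> L"
  interpret H: subgroup H G by fact
  interpret L: subgroup L G by fact
  have R: "subgroup ?R G"
  proof (rule subgroupI)
    show "?R \<subseteq> carrier G" by (auto simp: set_mult_def)
    show "?R \<noteq> {}" using H.one_closed L.one_closed unfolding set_mult_def by blast
  next
    fix a assume "a \<in> ?R"
    then obtain h l where hl: "h \<in> H" "l \<in> L" "a = h \<otimes> l" by (auto simp: set_mult_def)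
    have "inv a = (inv l \<otimes> inv h \<otimes> inv (inv l)) \<otimes> inv l"
      using hl by (simp add: inv_mult_group m_assoc)
    moreover have "inv l \<otimes> inv h \<otimes> inv (inv l) \<in> H" using norm hl by blast
    ultimately show "inv a \<in> ?R" using hl by (auto simp: set_mult_def)
  next
    fix a b assume "a \<in> ?R" "b \<in> ?R"
    then obtain h l h' l' where hl: "h \<in> H" "l \<in> L" "a = h \<otimes> l" "h' \<in> H" "l' \<in> L" "b = h' \<otimes> l'"
      by (auto simp: set_mult_def)
    have "a \<otimes> b = (h \<otimes> (l \<otimes> h' \<otimes> inv l)) \<otimes> (l \<otimes> l')"
      using hl by (simp add: m_assoc inv_mult_cancel_left)
    moreover have "h \<otimes> (l \<otimes> h' \<otimes> inv l) \<in> H" "l \<otimes> l' \<in> L" using norm hl by blast+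
    ultimately show "a \<otimes> b \<in> ?R" by (auto simp: set_mult_def)
  qed
  have pow: "\<exists>n::nat. a [^] (p ^ n) = \<one>" if "a \<in> ?R" for a
  proof -
    obtain h l where hl: "h \<in> H" "l \<in> L" "a = h \<otimes> l" using \<open>a \<in> ?R\<close> by (auto simp: set_mult_def)
    obtain n :: nat where n: "l [^] (p ^ n) = \<one>"
      using hl L p_sized_iff_elements[OF fin p] by blast
    have "l [^] k \<in> L" for k :: nat
      using hl(2) by (induction k) auto
    then obtain h' where h': "h' \<in> H" "a [^] (p ^ n) = h' \<otimes> l [^] (p ^ n)"
      using pow_mult_normalized[OF H(1) _ hl(1), of l "p ^ n"] norm hl L.mem_carrier by blast
    then have a: "a [^] (p ^ n) = h'" using n by simp
    obtain m :: nat where m: "h' [^] (p ^ m) = \<one>"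
      using h'(1) H p_sized_iff_elements[OF fin p] by blast
    have "a [^] (p ^ (n + m)) = (a [^] (p ^ n)) [^] (p ^ m)"
      using hl by (simp add: nat_pow_pow power_add)
    then show ?thesis using a m by auto
  qed
  have "H \<subseteq> ?R" 
  proof
    fix h assume "h \<in> H"
    then have "h = h \<otimes> \<one>" by simp
    then show "h \<in> ?R" using \<open>h \<in> H\<close> L.one_closed unfolding set_mult_def by blast
  qed
  moreover have "L \<subseteq> ?R"
  proof
    fix h assume "h \<in> L"
    then have "h = \<one> \<otimes> h" by simp
    then show "h \<in> ?R" using \<open>h \<in> L\<close> H.one_closed unfolding set_mult_def by blast
  qed
  ultimately show ?thesis using R pow p_sized_iff_elements[OF fin p R] by blast
qed

text \<open>The orbits that are not single points partition the moved points, and their sizes are divisors of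
\<open>p ^ n\<close> other than 1.\<close>

lemma (in group_action) prime_dvd_card_moved:
  assumes "finite E" "Factorial_Ring.prime p" "Coset.order G = p ^ n"
  shows "p dvd card {x \<in> E. \<exists>g\<in>carrier G. \<phi> g x \<noteq> x}" (is "p dvd card ?M")
proof -
  interpret G: group G using group_hom group_hom.axioms(1) by blast
  let ?C = "{orb \<in> orbits G E \<phi>. orb \<subseteq> ?M}"
  have orbE: "orbit G \<phi> x \<subseteq> E" if "x \<in> E" for x
    using that element_image unfolding orbit_def by blast
  have orbM: "orbit G \<phi> x \<subseteq> ?M" if x: "x \<in> ?M" for x
  proof
    fix y assume y: "y \<in> orbit G \<phi> x"
    have xE: "x \<in> E" using x by blast
    have yE: "y \<in> E" using orbE[OF xE] y by blast
    show "y \<in> ?M"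
    proof (rule ccontr)
      assume "y \<notin> ?M"
      then have fixy: "\<phi> g y = y" if "g \<in> carrier G" for g using yE that by blast
      have "x \<in> orbit G \<phi> y" using orbit_sym[OF xE yE y] .
      then have "x = y" using fixy unfolding orbit_def by auto
      then show False using \<open>y \<notin> ?M\<close> x by blast
    qed
  qed
  have un: "\<Union>?C = ?M"
  proof (intro equalityI subsetI)
    fix x assume x: "x \<in> ?M"
    then have "orbit G \<phi> x \<in> ?C" using orbM[OF x] unfolding orbits_def by blast
    then show "x \<in> \<Union>?C" using orbit_refl x by blast
  qed blast
  have "p dvd card (\<Union>?C)"
  proof (rule dvd_partition)
    show "finite (\<Union>?C)" using un assms(1) by simp
    show "\<forall>c1\<in>?C. \<forall>c2\<in>?C. c1 \<noteq> c2 \<longrightarrow> c1 \<inter> c2 = {}"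
      using disjoint_union by blast
    show "\<forall>c\<in>?C. p dvd card c"
    proof
      fix c assume c: "c \<in> ?C"
      then obtain x where x: "x \<in> E" "c = orbit G \<phi> x" unfolding orbits_def by blast
      have xc: "x \<in> c" using x orbit_refl by blast
      have "card c dvd p ^ n" using orbit_stabilizer_theorem[OF x(1)] x(2) assms(3) by (metis dvd_triv_left)
      then obtain k where k: "card c = p ^ k" using divides_primepow_nat[OF assms(2)] by blast
      have "x \<in> ?M" using xc c by blast
      then obtain g where g: "g \<in> carrier G" "\<phi> g x \<noteq> x" by blast
      have gx: "\<phi> g x \<in> c" using g(1) x(2) unfolding orbit_def by blast
      have "finite c" using c assms(1) x orbE finite_subset by blast
      then have "card {x, \<phi> g x} \<le> card c" using gx xc by (intro card_mono) auto
      then have "card c \<noteq> 1" using g(2) by auto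
      then have "k \<noteq> 0" using k by (metis power_0)
      then show "p dvd card c" using k by simp
    qed
  qed
  then show ?thesis using un by simp
qed

lemma (in group) coset_action:
  assumes P: "subgroup P G" and Q: "subgroup Q G"
  shows "group_action (G\<lparr>carrier := Q\<rparr>) (rcosets P) (\<lambda>q. \<lambda>C\<in>rcosets P. C #> inv q)"
proof -
  let ?E = "rcosets P" and ?\<phi> = "\<lambda>q. \<lambda>C\<in>rcosets P. C #> inv q"
  interpret P: subgroup P G by fact
  interpret Q: subgroup Q G by fact
  interpret QG: group "G\<lparr>carrier := Q\<rparr>" using Q by (rule subgroup_imp_group)
  have sub: "C \<subseteq> carrier G" if "C \<in> ?E" for C
    using that P.rcosets_carrier[OF is_group] by blast
  have closed: "C #> x \<in> ?E" if C: "C \<in> ?E" and x: "x \<in> carrier G" for C x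
  proof -
    obtain y where y: "y \<in> carrier G" "C = P #> y" using C by (auto simp: RCOSETS_def)
    then have "C #> x = P #> (y \<otimes> x)" using x P.subset by (simp add: coset_mult_assoc)
    then show ?thesis using y x P.subset by (auto intro: rcosetsI)
  qed
  have bij: "?\<phi> q \<in> Bij ?E" if q: "q \<in> carrier G" for q
  proof -
    have "bij_betw (?\<phi> q) ?E ?E"
      by (rule bij_betw_byWitness[where f' = "\<lambda>C. C #> q"])
        (use q sub closed in \<open>auto simp: coset_mult_assoc\<close>)
    then show ?thesis by (simp add: Bij_def)
  qed
  have hom: "?\<phi> \<in> hom (G\<lparr>carrier := Q\<rparr>) (BijGroup ?E)"
  proof (rule homI)
    fix x assume "x \<in> carrier (G\<lparr>carrier := Q\<rparr>)"
    then show "?\<phi> x \<in> carrier (BijGroup ?E)" using bij by (simp add: BijGroup_def)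
  next
    fix x y assume xy: "x \<in> carrier (G\<lparr>carrier := Q\<rparr>)" "y \<in> carrier (G\<lparr>carrier := Q\<rparr>)"
    then have xy: "x \<in> carrier G" "y \<in> carrier G" by auto
    have "?\<phi> (x \<otimes> y) = compose ?E (?\<phi> x) (?\<phi> y)"
      using xy sub closed by (auto simp: compose_def fun_eq_iff inv_mult_group coset_mult_assoc)
    then show "?\<phi> (x \<otimes>\<^bsub>G\<lparr>carrier := Q\<rparr>\<^esub> y) = ?\<phi> x \<otimes>\<^bsub>BijGroup ?E\<^esub> ?\<phi> y"
      using xy bij by (simp add: BijGroup_def)
  qed
  then show ?thesis
    using group_BijGroup[of ?E] QG.is_group
    by (auto simp: group_action_def group_hom_def group_hom_axioms_def)
qed

lemma (in group) coset_eq_iff_conj: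
  assumes "subgroup P G" "x \<in> carrier G" "q \<in> carrier G"
  shows "P #> x #> q = P #> x \<longleftrightarrow> x \<otimes> q \<otimes> inv x \<in> P"
proof -
  interpret P: subgroup P G by fact
  have "P #> x #> q = P #> (x \<otimes> q)" using assms P.subset by (simp add: coset_mult_assoc)
  moreover have "P #> (x \<otimes> q) = P #> x \<longleftrightarrow> x \<otimes> q \<in> P #> x"
    using assms repr_independence[OF _ assms(2,1)] rcos_self[of "x \<otimes> q" P] by fastforce
  moreover have "x \<otimes> q \<in> P #> x \<longleftrightarrow> x \<otimes> q \<otimes> inv x \<in> P"
    using assms by (intro P.rcos_module[OF is_group]) auto
  ultimately show ?thesis by simp
qed

text \<open>Two uses follow. If \<open>p\<close> does not divide the index of \<open>P\<close>, some coset is fixed by \<open>Q\<close>, which puts \<open>Q\<close>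
into a conjugate of \<open>P\<close>. If \<open>p\<close> divides the index and \<open>Q = P\<close>, the fixed coset \<open>P\<close> is not the only one.\<close>

lemma (in group) prime_dvd_card_moved_cosets:
  assumes fin: "finite (carrier G)" and p: "Factorial_Ring.prime p"
    and P: "subgroup P G" and Q: "subgroup Q G" "p_sized p Q"
  shows "p dvd card {C \<in> rcosets P. \<exists>q\<in>Q. C #> q \<noteq> C}"
proof -
  interpret Q: subgroup Q G by fact
  interpret A: group_action "G\<lparr>carrier := Q\<rparr>" "rcosets P" "\<lambda>q. \<lambda>C\<in>rcosets P. C #> inv q"
    using P Q(1) by (rule coset_action)
  obtain n where n: "card Q = p ^ n" using Q(2) unfolding p_sized_def by blast
  have "finite (rcosets P)" using fin by (auto simp: RCOSETS_def)
  then have "p dvd card {C \<in> rcosets P. \<exists>q\<in>Q. (\<lambda>C\<in>rcosets P. C #> inv q) C \<noteq> C}"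
    using A.prime_dvd_card_moved[OF _ p, of n] n by (simp add: Coset.order_def)
  moreover have "{C \<in> rcosets P. \<exists>q\<in>Q. (\<lambda>C\<in>rcosets P. C #> inv q) C \<noteq> C}
     = {C \<in> rcosets P. \<exists>q\<in>Q. C #> q \<noteq> C}"
    using Q.m_inv_closed by (auto) (metis Q.m_inv_closed Q.mem_carrier inv_inv)+
  ultimately show ?thesis by simp
qed

text \<open>Let \<open>K\<close> act on its own cosets in \<open>P\<close>. The number of fixed cosets is divisible by \<open>p\<close> and positive, since
\<open>K\<close> itself is fixed; a second fixed coset \<open>K #> g\<close> provides \<open>g\<close>.\<close>

lemma (in group) p_group_normalizer_grows:
  assumes fin: "finite (carrier G)" and p: "Factorial_Ring.prime p"
    and P: "subgroup P G" "p_sized p P" and K: "subgroup K G" "K \<subset> P"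
  shows "\<exists>g\<in>P - K. \<forall>k\<in>K. g \<otimes> k \<otimes> inv g \<in> K"
proof -
  let ?P = "G\<lparr>carrier := P\<rparr>"
  interpret P: subgroup P G by fact
  interpret K: subgroup K G by fact
  interpret PG: group ?P using P(1) by (rule subgroup_imp_group)
  have KP: "subgroup K ?P" using subgroup_incl[OF K(1) P(1)] K(2) by blast
  have finP: "finite P" using fin P.subset finite_subset by blast
  let ?R = "rcosets\<^bsub>?P\<^esub> K"
  have finR: "finite ?R" using finP by (auto simp: RCOSETS_def)
  have "K \<noteq> P" using K(2) by blast
  have lag: "card ?R * card K = card P" using PG.lagrange[OF KP] by (simp add: Coset.order_def)
  obtain n where n: "card P = p ^ n" using P(2) unfolding p_sized_def by blast
  have "card ?R \<noteq> 1"
    using lag psubset_card_mono[OF finP K(2)] by (metis less_irrefl mult_1)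
  moreover have "card ?R dvd p ^ n" using lag n by (metis dvd_triv_left)
  ultimately have dvd: "p dvd card ?R"
    using divides_primepow_nat[OF p] by (metis dvd_power neq0_conv power_0)
  let ?M = "{C \<in> ?R. \<exists>q\<in>K. C #>\<^bsub>?P\<^esub> q \<noteq> C}"
  have "p_sized p K" using p_sized_subgroup[OF fin p P(1) K(1) _ P(2)] K(2) by blast
  then have "p dvd card ?M"
    using PG.prime_dvd_card_moved_cosets[OF _ p KP KP] finP by simp
  then have "p dvd card (?R - ?M)"
    using dvd finR by (simp add: card_Diff_subset card_mono dvd_diff_nat)
  moreover have K0: "K \<in> ?R - ?M"
  proof -
    have "K \<in> ?R" using subgroup.subgroup_in_rcosets[OF KP PG.is_group] .
    then show ?thesis using K.rcos_const[OF is_group] by auto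
  qed
  ultimately have "card (?R - ?M) \<noteq> 1" using p by auto
  then have "?R - ?M \<noteq> {K}" by (metis card_1_singleton_iff One_nat_def)
  then obtain C where "C \<in> ?R - ?M" "C \<noteq> K" using K0 by blast
  then have C: "C \<in> ?R" "C \<noteq> K" "\<forall>q\<in>K. C #> q = C" by auto
  then obtain x where x: "x \<in> P" "C = K #> x" by (auto simp: RCOSETS_def)
  have "x \<notin> K" using x C(2) K.rcos_const[OF is_group] by blast
  moreover have "\<forall>k\<in>K. x \<otimes> k \<otimes> inv x \<in> K"
    using C(3) x coset_eq_iff_conj[OF K(1)] P.mem_carrier by auto
  ultimately show ?thesis using x(1) by blast
qed

text \<open>A form of "normalizers grow" for the trace of a p-group on a conjugation-closed set \<open>D\<close>. Let \<open>K\<close> be the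
normalizer of \<open>E = P \<inter> R \<inter> D\<close> in \<open>P\<close>. If \<open>K\<close> met \<open>D\<close> only in \<open>E\<close>, then everything in \<open>P\<close> that normalizes
\<open>K\<close> would normalize \<open>K \<inter> D = E\<close>, so \<open>K\<close> would be its own normalizer in \<open>P\<close>. Hence \<open>K = P\<close>, against
\<open>E \<noteq> P \<inter> D\<close>.\<close>

lemma (in group) normal_p_sets_grow:
  assumes fin: "finite (carrier G)" and p: "Factorial_Ring.prime p"
    and D: "\<And>g d. g \<in> carrier G \<Longrightarrow> d \<in> D \<Longrightarrow> g \<otimes> d \<otimes> inv g \<in> D"
    and P: "subgroup P G" "p_sized p P" and R: "subgroup R G"
    and ne: "P \<inter> R \<inter> D \<noteq> P \<inter> D"
  shows "\<exists>x\<in>P \<inter> D - R. \<forall>e\<in>P \<inter> R \<inter> D. x \<otimes> e \<otimes> inv x \<in> P \<inter> R \<inter> D"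
proof -
  interpret P: subgroup P G by fact
  interpret R: subgroup R G by fact
  define E where "E = P \<inter> R \<inter> D"
  define K where "K = {k \<in> P. \<forall>e\<in>carrier G. k \<otimes> e \<otimes> inv k \<in> E \<longleftrightarrow> e \<in> E}"
  have K_iff: "k \<in> K \<longleftrightarrow> k \<in> P \<and> (\<forall>e\<in>carrier G. k \<otimes> e \<otimes> inv k \<in> E \<longleftrightarrow> e \<in> E)" for k
    unfolding K_def by blast
  have EP: "E \<subseteq> P" "E \<subseteq> carrier G" unfolding E_def using P.subset by blast+
  have KP: "K \<subseteq> P" "K \<subseteq> carrier G" unfolding K_def using P.subset by blast+
  have conj_eq: "x \<otimes> e \<otimes> inv x \<in> E \<longleftrightarrow> e \<in> E"
    if x: "x \<in> carrier G" "\<And>e. e \<in> E \<Longrightarrow> x \<otimes> e \<otimes> inv x \<in> E" and e: "e \<in> carrier G" for x e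
  proof -
    have finE: "finite E" using fin EP(2) finite_subset by blast
    have inj: "inj_on (\<lambda>e. x \<otimes> e \<otimes> inv x) (carrier G)"
      using x(1) by (intro inj_onI) simp
    have "inj_on (\<lambda>e. x \<otimes> e \<otimes> inv x) E"
      using inj EP(2) by (rule inj_on_subset)
    then have im: "(\<lambda>e. x \<otimes> e \<otimes> inv x) ` E = E"
      using x(2) finE by (intro endo_inj_surj) auto
    show ?thesis using inj_on_image_mem_iff[OF inj e EP(2)] unfolding im .
  qed
  have K: "subgroup K G"
  proof (rule subgroupI)
    show "K \<subseteq> carrier G" by (rule KP)
    have "\<one> \<in> K" using P.one_closed by (simp add: K_iff)
    then show "K \<noteq> {}" by blast
  next
    fix a assume a: "a \<in> K"
    have "inv a \<otimes> e \<otimes> inv (inv a) \<in> E \<longleftrightarrow> e \<in> E" if e: "e \<in> carrier G" for e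
    proof -
      have aG: "a \<in> carrier G" using a KP by blast
      have "a \<otimes> (inv a \<otimes> e \<otimes> inv (inv a)) \<otimes> inv a = e"
        using aG e by (simp add: m_assoc inv_mult_cancel_left)
      moreover have "inv a \<otimes> e \<otimes> inv (inv a) \<in> carrier G" using aG e by simp
      ultimately show ?thesis using a unfolding K_iff by metis
    qed
    then show "inv a \<in> K" using a by (simp add: K_iff)
  next
    fix a b assume a: "a \<in> K" and b: "b \<in> K"
    have "(a \<otimes> b) \<otimes> e \<otimes> inv (a \<otimes> b) \<in> E \<longleftrightarrow> e \<in> E" if e: "e \<in> carrier G" for e
    proof -
      have ab: "a \<in> carrier G" "b \<in> carrier G" using a b KP by blast+
      have "(a \<otimes> b) \<otimes> e \<otimes> inv (a \<otimes> b) = a \<otimes> (b \<otimes> e \<otimes> inv b) \<otimes> inv a"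
        using ab e by (simp add: m_assoc inv_mult_group)
      moreover have "b \<otimes> e \<otimes> inv b \<in> carrier G" using ab e by simp
      ultimately show ?thesis using a b e unfolding K_iff by metis
    qed
    then show "a \<otimes> b \<in> K" using a b by (simp add: K_iff)
  qed
  have EK: "E \<subseteq> K"
  proof
    fix e assume e: "e \<in> E"
    then have eG: "e \<in> carrier G" using EP by blast
    have "e \<otimes> e' \<otimes> inv e \<in> E" if "e' \<in> E" for e'
      using that e D[OF eG, of e'] unfolding E_def by auto
    then show "e \<in> K" using conj_eq[OF eG] e EP unfolding K_iff by blast
  qed
  have "K \<inter> D \<noteq> E"
  proof
    assume KD: "K \<inter> D = E"
    then have "K \<noteq> P" using ne unfolding E_def by blast
    then have "K \<subset> P" using KP by blast
    from p_group_normalizer_grows[OF fin p P K this]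
    obtain g where g: "g \<in> P - K" "\<forall>k\<in>K. g \<otimes> k \<otimes> inv g \<in> K" by (rule bexE)
    have gG: "g \<in> carrier G" using g(1) by auto
    have "g \<otimes> e \<otimes> inv g \<in> E" if e: "e \<in> E" for e
    proof -
      have "e \<in> K" "e \<in> D" using e EK unfolding E_def by auto
      then show ?thesis using g(2) D[OF gG] unfolding KD[symmetric] by blast
    qed
    then have "g \<in> K" using conj_eq[OF gG] g(1) unfolding K_iff by blast
    then show False using g(1) by blast
  qed
  then obtain x where x: "x \<in> K" "x \<in> D" "x \<notin> E" using EK unfolding E_def by blast
  then have "x \<in> P \<inter> D - R" using KP unfolding E_def by blast
  moreover have "\<forall>e\<in>E. x \<otimes> e \<otimes> inv x \<in> E" using x(1) EP unfolding K_iff by blast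
  ultimately show ?thesis unfolding E_def by blast
qed

lemma (in group) generate_conj_closed:
  assumes S: "S \<subseteq> carrier G" and x: "x \<in> carrier G"
    and conj: "\<And>s. s \<in> S \<Longrightarrow> x \<otimes> s \<otimes> inv x \<in> S" and h: "h \<in> generate G S"
  shows "x \<otimes> h \<otimes> inv x \<in> generate G S"
  using h
proof induction
  case one
  then show ?case using x by (simp add: generate.one)
next
  case (incl s)
  then show ?case using conj by (simp add: generate.incl)
next
  case (inv s)
  have "s \<in> carrier G" using inv S by blast
  then have "x \<otimes> inv s \<otimes> inv x = inv (x \<otimes> s \<otimes> inv x)"
    using x by (simp add: inv_mult_group m_assoc)
  then show ?case using conj[OF inv] by (simp add: generate.inv)
next
  case (eng a b)
  have "a \<in> carrier G" "b \<in> carrier G" using eng S generate_in_carrier by blast+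
  then have "x \<otimes> (a \<otimes> b) \<otimes> inv x = (x \<otimes> a \<otimes> inv x) \<otimes> (x \<otimes> b \<otimes> inv x)"
    using x by (simp add: m_assoc inv_mult_cancel_left)
  then show ?case using eng by (simp add: generate.eng)
qed

text \<open>The elements that conjugate \<open>generate G S\<close> into itself are closed under products; in a finite group the
inverse of an element is one of its powers, so they form a subgroup.\<close>

lemma (in group) generate_normalizes:
  assumes fin: "finite (carrier G)" and S: "S \<subseteq> carrier G" and T: "T \<subseteq> carrier G"
    and conj: "\<And>t s. t \<in> T \<Longrightarrow> s \<in> S \<Longrightarrow> t \<otimes> s \<otimes> inv t \<in> S"
    and l: "l \<in> generate G T" and h: "h \<in> generate G S"
  shows "l \<otimes> h \<otimes> inv l \<in> generate G S"
proof -
  define N where "N = {g \<in> carrier G. \<forall>h\<in>generate G S. g \<otimes> h \<otimes> inv g \<in> generate G S}"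
  have hG: "h \<in> carrier G" if "h \<in> generate G S" for h
    using generate_in_carrier[OF S that] .
  have NG: "a \<in> carrier G" if "a \<in> N" for a using that unfolding N_def by blast
  have TN: "T \<subseteq> N" using generate_conj_closed[OF S] conj T unfolding N_def by blast
  have oneN: "\<one> \<in> N" unfolding N_def using hG by simp
  have mult: "a \<otimes> b \<in> N" if a: "a \<in> N" and b: "b \<in> N" for a b
  proof -
    have "(a \<otimes> b) \<otimes> h \<otimes> inv (a \<otimes> b) \<in> generate G S" if h: "h \<in> generate G S" for h
    proof -
      have "(a \<otimes> b) \<otimes> h \<otimes> inv (a \<otimes> b) = a \<otimes> (b \<otimes> h \<otimes> inv b) \<otimes> inv a"
        using NG[OF a] NG[OF b] hG[OF h] by (simp add: m_assoc inv_mult_group)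
      then show ?thesis using a b h unfolding N_def by simp
    qed
    then show ?thesis using NG[OF a] NG[OF b] unfolding N_def by simp
  qed
  have invN: "inv a \<in> N" if a: "a \<in> N" for a
  proof -
    have pw: "a [^] n \<in> N" for n :: nat
      using oneN mult[OF _ a] by (induction n) auto
    have "a [^] (Coset.order G) = \<one>" using NG[OF a] by (rule pow_order_eq_1)
    moreover obtain m where m: "Coset.order G = Suc m"
      using order_gt_0_iff_finite fin gr0_implies_Suc by metis
    ultimately have "inv a = a [^] m" using NG[OF a] by (intro inv_equality) auto
    then show ?thesis using pw by metis
  qed
  have "l \<in> N" using l
  proof induction
    case one then show ?case by (rule oneN)
  next
    case (incl s) then show ?case using TN by blast
  next
    case (inv s) then show ?case using TN invN by blast
  next
    case (eng a b) then show ?case using mult by blast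
  qed
  then show ?thesis using h unfolding N_def by blast
qed

text \<open>The argument of Alperin and Lyons, with the sets \<open>P \<inter> D\<close> for p-subgroups \<open>P\<close> in place of Sylow subgroups,
so that conjugacy of Sylow subgroups does not enter. Suppose that two maximal sets \<open>A\<close> and \<open>B\<close> of this form
differ, and choose them with the largest intersection \<open>E\<close>. Elements \<open>x \<in> A - E\<close> and \<open>y \<in> B - E\<close> that normalize
\<open>E\<close> generate a p-group that normalizes \<open>generate G E\<close>; so \<open>E\<close>, \<open>x\<close> and \<open>y\<close> lie in one p-group and in
one maximal set \<open>C\<close>. Now \<open>C\<close> meets both \<open>A\<close> and \<open>B\<close> in more than \<open>E\<close>, which forces \<open>A = C = B\<close>. With only
one maximal set, every element of \<open>D\<close> lies in the same p-group.\<close>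

theorem (in group) Baer_Suzuki:
  assumes fin: "finite (carrier G)" and p: "Factorial_Ring.prime p" and DG: "D \<subseteq> carrier G"
    and D: "\<And>g d. g \<in> carrier G \<Longrightarrow> d \<in> D \<Longrightarrow> g \<otimes> d \<otimes> inv g \<in> D"
    and pair: "\<And>x y. x \<in> D \<Longrightarrow> y \<in> D \<Longrightarrow> p_sized p (generate G {x, y})"
  shows "p_sized p (generate G D)"
proof -
  define F where "F = {P \<inter> D | P. subgroup P G \<and> p_sized p P}"
  have finD: "finite D" using DG fin finite_subset by blast
  have "F \<subseteq> Pow D" unfolding F_def by blast
  then have finF: "finite F" using finD finite_subset finite_Pow_iff by metis
  define maximal where "maximal A \<longleftrightarrow> A \<in> F \<and> (\<forall>B\<in>F. A \<subseteq> B \<longrightarrow> B = A)" for A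
  have ex_max: "\<exists>B. maximal B \<and> A \<subseteq> B" if "A \<in> F" for A
    using finite_has_maximal2[OF finF that] unfolding maximal_def by metis
  have unique: "A = B" if "maximal A" "maximal B" for A B
  proof (rule ccontr)
    assume "A \<noteq> B"
    let ?Prs = "{(A, B). maximal A \<and> maximal B \<and> A \<noteq> B}"
    have "finite ?Prs"
      by (rule finite_subset[of _ "F \<times> F"]) (auto simp: maximal_def finF)
    moreover have "?Prs \<noteq> {}" using that \<open>A \<noteq> B\<close> by blast
    ultimately have "Max ((\<lambda>(A, B). card (A \<inter> B)) ` ?Prs) \<in> (\<lambda>(A, B). card (A \<inter> B)) ` ?Prs"
      by (intro Max_in) auto
    then obtain A B where "(A, B) \<in> ?Prs"
      and mx: "card (A \<inter> B) = Max ((\<lambda>(A, B). card (A \<inter> B)) ` ?Prs)"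
      by (elim imageE) (metis (no_types, lifting) case_prod_conv surj_pair)
    then have AB: "maximal A" "maximal B" "A \<noteq> B" by blast+
    have best: "card (A' \<inter> B') \<le> card (A \<inter> B)"
      if "maximal A'" "maximal B'" "A' \<noteq> B'" for A' B'
    proof -
      have "(A', B') \<in> ?Prs" using that by blast
      then have "card (A' \<inter> B') \<in> (\<lambda>(A, B). card (A \<inter> B)) ` ?Prs" by (rule rev_image_eqI) simp
      then show ?thesis unfolding mx using \<open>finite ?Prs\<close> by (intro Max_ge) auto
    qed
    obtain P where P: "subgroup P G" "p_sized p P" "A = P \<inter> D"
      using AB(1) unfolding maximal_def F_def by blast
    obtain Q where Q: "subgroup Q G" "p_sized p Q" "B = Q \<inter> D"
      using AB(2) unfolding maximal_def F_def by blast
    let ?E = "A \<inter> B"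
    have nA: "?E \<noteq> A" and nB: "?E \<noteq> B" using AB unfolding maximal_def by blast+
    have EA: "?E = P \<inter> Q \<inter> D" and EB: "?E = Q \<inter> P \<inter> D" using P(3) Q(3) by auto
    obtain x where x: "x \<in> A - ?E" "\<forall>e\<in>?E. x \<otimes> e \<otimes> inv x \<in> ?E"
      using normal_p_sets_grow[OF fin p D P(1,2) Q(1)] nA P(3) Q(3) unfolding EA by blast
    obtain y where y: "y \<in> B - ?E" "\<forall>e\<in>?E. y \<otimes> e \<otimes> inv y \<in> ?E"
      using normal_p_sets_grow[OF fin p D Q(1,2) P(1)] nB P(3) Q(3) unfolding EB by blast
    have xy: "x \<in> D" "y \<in> D" "x \<in> carrier G" "y \<in> carrier G" using x y P(3) Q(3) DG by auto
    have EG: "?E \<subseteq> carrier G" using P(3) DG by blast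
    let ?H = "generate G ?E" and ?L = "generate G {x, y}"
    have H: "subgroup ?H G" using EG by (rule generate_is_subgroup)
    have L: "subgroup ?L G" using xy by (intro generate_is_subgroup) auto
    have "?H \<subseteq> P" by (rule generate_subgroup_incl[OF _ P(1)]) (use P(3) in blast)
    then have pH: "p_sized p ?H" using p_sized_subgroup[OF fin p P(1) H _ P(2)] by blast
    have norm: "l \<otimes> h \<otimes> inv l \<in> ?H" if "l \<in> ?L" "h \<in> ?H" for l h
    proof (rule generate_normalizes[OF fin EG _ _ that])
      show "{x, y} \<subseteq> carrier G" using xy by blast
      show "t \<otimes> s \<otimes> inv t \<in> ?E" if "t \<in> {x, y}" "s \<in> ?E" for t s
        using that x(2) y(2) by blast
    qed
    \<comment> \<open>\<open>R\<close> is a p-group that contains \<open>E\<close>, \<open>x\<close> and \<open>y\<close> at once.\<close>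
    obtain R where R: "subgroup R G" "p_sized p R" "?H \<union> ?L \<subseteq> R"
      using p_sized_join[OF fin p H pH L pair[OF xy(1,2)] norm] by blast
    have "R \<inter> D \<in> F" unfolding F_def using R by blast
    then obtain C where C: "maximal C" "R \<inter> D \<subseteq> C" using ex_max by blast
    have "?E \<union> {x, y} \<subseteq> R \<inter> D"
      using R(3) xy P(3) generate.incl[of _ ?E G] generate.incl[of _ "{x, y}" G] by blast
    then have EC: "?E \<union> {x, y} \<subseteq> C" using C(2) by blast
    have finsub: "finite S" if "S \<subseteq> D" for S using that DG fin finite_subset by metis
    have "C = A"
    proof (rule ccontr)
      assume "C \<noteq> A"
      then have le: "card (C \<inter> A) \<le> card ?E" using best C(1) AB(1) by blast
      have "?E \<subset> C \<inter> A" using EC x(1) by blast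
      moreover have "finite (C \<inter> A)" using finsub P(3) by blast
      ultimately have "card ?E < card (C \<inter> A)" by (rule psubset_card_mono[rotated])
      then show False using le by simp
    qed
    moreover have "C = B"
    proof (rule ccontr)
      assume "C \<noteq> B"
      then have le: "card (C \<inter> B) \<le> card ?E" using best C(1) AB(2) by blast
      have "?E \<subset> C \<inter> B" using EC y(1) by blast
      moreover have "finite (C \<inter> B)" using finsub Q(3) by blast
      ultimately have "card ?E < card (C \<inter> B)" by (rule psubset_card_mono[rotated])
      then show False using le by simp
    qed
    ultimately show False using AB(3) by blast
  qed
  have "p_sized p {\<one>}" unfolding p_sized_def by (intro exI[of _ 0]) simp
  then have "{\<one>} \<inter> D \<in> F" unfolding F_def using triv_subgroup by blast
  then obtain A where A: "maximal A" using ex_max by blast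
  then obtain P where P: "subgroup P G" "p_sized p P" "A = P \<inter> D"
    unfolding maximal_def F_def by blast
  have "D \<subseteq> P"
  proof
    fix x assume x: "x \<in> D"
    have "subgroup (generate G {x, x}) G" using x DG by (intro generate_is_subgroup) auto
    then have "generate G {x, x} \<inter> D \<in> F" unfolding F_def using pair[OF x x] by blast
    then obtain B where "maximal B" "generate G {x, x} \<inter> D \<subseteq> B" using ex_max by blast
    then show "x \<in> P" using unique[OF A] P(3) x generate.incl[of x "{x, x}" G] by blast
  qed
  then have "generate G D \<subseteq> P" using generate_subgroup_incl P(1) by blast
  then show ?thesis
    using p_sized_subgroup[OF fin p P(1) generate_is_subgroup[OF DG] _ P(2)] by blast
qed

text \<open>Let \<open>P\<close> be a Sylow p-subgroup. A pair that generates a p-group fixes one of the \<open>m\<close> cosets of \<open>P\<close>, and the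
elements that fix a given coset form a conjugate of \<open>P\<close>. This leaves \<open>m * (p ^ a)\<^sup>2\<close> pairs, which is the
fraction \<open>1 / m\<close> of \<open>(p ^ a * m)\<^sup>2\<close>.\<close>

lemma (in group) card_p_generating_pairs_le:
  assumes fin: "finite (carrier G)" and p: "Factorial_Ring.prime p"
    and ord: "Coset.order G = p ^ a * m" "\<not> p dvd m"
  shows "card {(x, y). x \<in> carrier G \<and> y \<in> carrier G \<and> p_sized p (generate G {x, y})} * m
    \<le> Coset.order G * Coset.order G"
proof -
  obtain P where P: "subgroup P G" "card P = p ^ a" using sylow_thm[OF p is_group ord(1) fin] by blast
  interpret P: subgroup P G by fact
  have ppos: "p > 0" using p prime_gt_0_nat by blast
  have idx: "card (rcosets P) = m" using lagrange[OF P(1)] ord(1) P(2) ppos by simp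
  have finR: "finite (rcosets P)" using fin by (auto simp: RCOSETS_def)
  let ?S = "\<lambda>C. {q \<in> carrier G. C #> q = C}"
  have cardS: "card (?S C) \<le> p ^ a" if C: "C \<in> rcosets P" for C
  proof -
    obtain x where x: "x \<in> carrier G" "C = P #> x" using C by (auto simp: RCOSETS_def)
    have "inj_on (\<lambda>q. x \<otimes> q \<otimes> inv x) (?S C)" using x(1) by (intro inj_onI) simp
    moreover have "(\<lambda>q. x \<otimes> q \<otimes> inv x) ` (?S C) \<subseteq> P" using coset_eq_iff_conj[OF P(1) x(1)] x(2) by blast
    moreover have "finite P" using fin P.subset finite_subset by blast
    ultimately show ?thesis using P(2) card_inj_on_le by metis
  qed
  let ?X = "{(x, y). x \<in> carrier G \<and> y \<in> carrier G \<and> p_sized p (generate G {x, y})}"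
  have "?X \<subseteq> (\<Union>C\<in>rcosets P. ?S C \<times> ?S C)"
  proof clarify
    fix x y assume xy: "x \<in> carrier G" "y \<in> carrier G" "p_sized p (generate G {x, y})"
    have sub: "subgroup (generate G {x, y}) G" using xy by (intro generate_is_subgroup) auto
    let ?M = "{C \<in> rcosets P. \<exists>q\<in>generate G {x, y}. C #> q \<noteq> C}"
    have "p dvd card ?M" by (rule prime_dvd_card_moved_cosets[OF fin p P(1) sub xy(3)])
    then have "?M \<noteq> rcosets P" using ord(2) idx by metis
    then obtain C where "C \<in> rcosets P" "\<forall>q\<in>generate G {x, y}. C #> q = C" by blast
    then show "(x, y) \<in> (\<Union>C\<in>rcosets P. ?S C \<times> ?S C)"
      using xy generate.incl[of _ "{x, y}" G] by blast
  qed
  moreover have "finite (\<Union>C\<in>rcosets P. ?S C \<times> ?S C)" using finR fin by auto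
  ultimately have "card ?X \<le> card (\<Union>C\<in>rcosets P. ?S C \<times> ?S C)" by (rule card_mono[rotated])
  also have "\<dots> \<le> (\<Sum>C\<in>rcosets P. card (?S C \<times> ?S C))" by (rule card_UN_le[OF finR])
  also have "\<dots> \<le> (\<Sum>C\<in>rcosets P. p ^ a * p ^ a)"
    using cardS by (intro sum_mono) (simp add: card_cartesian_product mult_mono)
  also have "\<dots> = m * (p ^ a * p ^ a)" using idx by simp
  finally have "card ?X * m \<le> m * (p ^ a * p ^ a) * m" by (rule mult_le_mono1)
  then show ?thesis using ord(1) by (simp add: mult.assoc mult.left_commute)
qed

section \<open>Open normal subgroups and finite quotients\<close>

lemma card_image_cong_kernel:
  assumes "\<And>x y. x \<in> A \<Longrightarrow> y \<in> A \<Longrightarrow> f x = f y \<longleftrightarrow> g x = g y"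
  shows "card (f ` A) = card (g ` A)"
proof -
  have "bij_betw (\<lambda>z. g (inv_into A f z)) (f ` A) (g ` A)"
  proof (rule bij_betw_imageI)
    show "inj_on (\<lambda>z. g (inv_into A f z)) (f ` A)"
      by (rule inj_onI) (metis assms f_inv_into_f inv_into_into)
    have *: "g (inv_into A f (f x)) = g x" if "x \<in> A" for x
      using that assms by (meson f_inv_into_f imageI inv_into_into)
    show "(\<lambda>z. g (inv_into A f z)) ` f ` A = g ` A"
      unfolding image_image using * by (intro image_cong) auto
  qed
  then show ?thesis by (rule bij_betw_same_card)
qed

lemma Union_Diff_pairwise_disjnt:
  assumes "pairwise disjnt R" "A \<subseteq> R"
  shows "\<Union>R - \<Union>A = \<Union>(R - A)"
proof (intro equalityI subsetI)
  fix x assume "x \<in> \<Union>(R - A)"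
  then obtain C where C: "x \<in> C" "C \<in> R" "C \<notin> A" by blast
  have "x \<notin> D" if "D \<in> A" for D
    using assms C that by (metis disjnt_iff pairwiseD subsetD)
  then show "x \<in> \<Union>R - \<Union>A" using C by blast
qed blast

context topological_group
begin

lemma continuous_translations:
  assumes "c \<in> carrier G"
  shows "continuous_map T T (\<lambda>x. c \<otimes> x)" "continuous_map T T (\<lambda>x. x \<otimes> c)"
proof -
  have c: "continuous_map T T (\<lambda>x. c)" and i: "continuous_map T T (\<lambda>x. x)"
    using assms by (simp_all add: topspace_eq_carrier)
  have "continuous_map T T ((\<lambda>(x, y). x \<otimes> y) \<circ> (\<lambda>x. (c, x)))"
    by (rule continuous_map_compose[OF _ continuous_mult]) (use c i in \<open>simp add: continuous_map_paired\<close>)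
  then show "continuous_map T T (\<lambda>x. c \<otimes> x)" by (simp add: o_def)
  have "continuous_map T T ((\<lambda>(x, y). x \<otimes> y) \<circ> (\<lambda>x. (x, c)))"
    by (rule continuous_map_compose[OF _ continuous_mult]) (use c i in \<open>simp add: continuous_map_paired\<close>)
  then show "continuous_map T T (\<lambda>x. x \<otimes> c)" by (simp add: o_def)
qed

lemma translate_eq_preimage:
  assumes "S \<subseteq> carrier G" "x \<in> carrier G"
  shows "S #> x = {y \<in> topspace T. y \<otimes> inv x \<in> S}"
proof -
  have "y \<in> S #> x" if "y \<in> carrier G" "y \<otimes> inv x \<in> S" for y
  proof -
    have "y = (y \<otimes> inv x) \<otimes> x" using that assms by (simp add: m_assoc)
    then show ?thesis using that(2) unfolding r_coset_def by blast
  qed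
  then show ?thesis using assms by (auto simp: r_coset_def topspace_eq_carrier m_assoc subset_iff)
qed

lemma openin_r_coset:
  assumes "openin T S" "x \<in> carrier G"
  shows "openin T (S #> x)"
proof -
  have "S \<subseteq> carrier G" using openin_subset[OF assms(1)] by (simp add: topspace_eq_carrier)
  then show ?thesis
    using openin_continuous_map_preimage[OF continuous_translations(2)[OF inv_closed[OF assms(2)]] assms(1)]
      translate_eq_preimage assms(2) by simp
qed

lemma closedin_r_coset:
  assumes "closedin T S" "x \<in> carrier G"
  shows "closedin T (S #> x)"
proof -
  have "S \<subseteq> carrier G" using closedin_subset[OF assms(1)] by (simp add: topspace_eq_carrier)
  then show ?thesis
    using closedin_continuous_map_preimage[OF continuous_translations(2)[OF inv_closed[OF assms(2)]] assms(1)]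
      translate_eq_preimage assms(2) by simp
qed

lemma openin_Union_cosets:
  assumes "openin T N" "A \<subseteq> rcosets N"
  shows "openin T (\<Union>A)"
  using assms openin_r_coset by (intro openin_Union) (auto simp: RCOSETS_def)

lemma closedin_Union_cosets:
  assumes N: "subgroup N G" "openin T N" and A: "A \<subseteq> rcosets N"
  shows "closedin T (\<Union>A)"
proof -
  have "\<Union>A = topspace T - \<Union>(rcosets N - A)"
    using Union_Diff_pairwise_disjnt[OF rcos_disjoint[OF N(1)], of "rcosets N - A"] A
    unfolding topspace_eq_carrier rcosets_part_G[OF N(1)] by (simp add: double_diff)
  moreover have "openin T (\<Union>(rcosets N - A))"
    by (rule openin_Union_cosets[OF N(2)]) blast
  ultimately show ?thesis by auto
qed

lemma open_subgroup_closed: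
  assumes "subgroup N G" "openin T N"
  shows "closedin T N"
  using closedin_Union_cosets[OF assms, of "{N}"] subgroup.subgroup_in_rcosets[OF assms(1) is_group]
  by simp

lemma open_subgroup_finite_index:
  assumes "compact_space T" and N: "subgroup N G" "openin T N"
  shows "finite (rcosets N)"
proof -
  have "topspace T \<subseteq> \<Union>(rcosets N)"
    using rcosets_part_G[OF N(1)] by (simp add: topspace_eq_carrier)
  moreover have "\<forall>U\<in>rcosets N. openin T U" using openin_r_coset[OF N(2)] by (auto simp: RCOSETS_def)
  ultimately obtain F where F: "finite F" "F \<subseteq> rcosets N" "topspace T \<subseteq> \<Union>F"
    using assms(1) unfolding compact_space_alt by metis
  have "C \<in> F" if C: "C \<in> rcosets N" for C
  proof -
    have "C \<noteq> {}" using subgroup.rcosets_non_empty[OF N(1) C] .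
    then obtain x where x: "x \<in> C" by blast
    then have "x \<in> topspace T" using rcosets_part_G[OF N(1)] C unfolding topspace_eq_carrier by blast
    then obtain D where D: "D \<in> F" "x \<in> D" using F(3) by blast
    then have "C = D" using rcos_disjoint[OF N(1)] C F(2) x unfolding pairwise_def disjnt_def by blast
    then show ?thesis using D(1) by simp
  qed
  then have "rcosets N \<subseteq> F" by (rule subsetI)
  then show ?thesis using F(1) by (rule finite_subset)
qed

lemma closed_finite_index_open:
  assumes K: "subgroup K G" "closedin T K" "finite (rcosets K)"
  shows "openin T K"
proof -
  have "K = topspace T - \<Union>(rcosets K - {K})"
    using Union_Diff_pairwise_disjnt[OF rcos_disjoint[OF K(1)], of "rcosets K - {K}"]
      subgroup.subgroup_in_rcosets[OF K(1) is_group]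
    unfolding topspace_eq_carrier rcosets_part_G[OF K(1)] by (simp add: double_diff)
  moreover have "closedin T (\<Union>(rcosets K - {K}))"
    using K(3) closedin_r_coset[OF K(2)] by (intro closedin_Union) (auto simp: RCOSETS_def)
  ultimately show ?thesis using openin_diff[OF openin_topspace] by metis
qed

lemma open_subgroup_supergroup:
  assumes "subgroup H G" "subgroup K G" "H \<subseteq> K" "openin T H"
  shows "openin T K"
proof -
  have "K = (\<Union>x\<in>K. H #> x)"
  proof (intro equalityI subsetI)
    fix x assume x: "x \<in> K"
    then have "x \<in> H #> x" using rcos_self[OF _ assms(1)] subgroup.mem_carrier[OF assms(2)] by blast
    then show "x \<in> (\<Union>x\<in>K. H #> x)" using x by blast
  next
    fix y assume "y \<in> (\<Union>x\<in>K. H #> x)"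
    then obtain x h where "x \<in> K" "h \<in> H" "y = h \<otimes> x" unfolding r_coset_def by blast
    then show "y \<in> K" using subgroup.m_closed[OF assms(2)] assms(3) by blast
  qed
  moreover have "openin T (\<Union>x\<in>K. H #> x)"
    using openin_r_coset[OF assms(4)] subgroup.mem_carrier[OF assms(2)] by (intro openin_Union) blast
  ultimately show ?thesis by simp
qed

text \<open>The complement is the projection of a closed subset of \<open>T \<times> T\<close> along a compact factor, hence closed. With
multiplication as \<open>f\<close> this gives open stabilizers of clopen sets, with conjugation open normal subgroups.\<close>

lemma open_transporter:
  assumes comp: "compact_space T" and f: "continuous_map (prod_topology T T) T f"
    and C: "closedin T C" and W: "openin T W"
  shows "openin T {g \<in> carrier G. \<forall>u\<in>C. f (u, g) \<in> W}"
proof -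
  let ?Z = "{z \<in> topspace (prod_topology T T). fst z \<in> C} \<inter> {z \<in> topspace (prod_topology T T). f z \<in> topspace T - W}"
  have "closedin (prod_topology T T) ?Z"
    using closedin_continuous_map_preimage[OF continuous_map_fst C]
      closedin_continuous_map_preimage[OF f closedin_diff[OF closedin_topspace W]]
    by (rule closedin_Int)
  then have "closedin T (snd ` ?Z)"
    using Abstract_Topological_Spaces.closed_map_snd[OF comp, of T] unfolding closed_map_def by blast
  moreover have "{g \<in> carrier G. \<forall>u\<in>C. f (u, g) \<in> W} = topspace T - snd ` ?Z"
  proof -
    have CT: "C \<subseteq> topspace T" using closedin_subset[OF C] .
    have fT: "f z \<in> topspace T" if "z \<in> topspace (prod_topology T T)" for z
      using continuous_map_image_subset_topspace[OF f] that by blast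
    have "g \<in> snd ` ?Z \<longleftrightarrow> (\<exists>u\<in>C. f (u, g) \<notin> W)" if g: "g \<in> topspace T" for g
    proof
      assume "g \<in> snd ` ?Z"
      then show "\<exists>u\<in>C. f (u, g) \<notin> W" by force
    next
      assume "\<exists>u\<in>C. f (u, g) \<notin> W"
      then obtain u where u: "u \<in> C" "f (u, g) \<notin> W" by blast
      then have "(u, g) \<in> topspace (prod_topology T T)" using CT g by auto
      then have "(u, g) \<in> ?Z" using u fT by auto
      then show "g \<in> snd ` ?Z" by (rule rev_image_eqI) simp
    qed
    then show ?thesis unfolding topspace_eq_carrier[symmetric] by blast
  qed
  ultimately show ?thesis by auto
qed

lemma continuous_conjugation:
  "continuous_map (prod_topology T T) T (\<lambda>(x, g). x \<otimes> g \<otimes> inv x)"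
proof -
  have i: "continuous_map (prod_topology T T) T (\<lambda>z. inv (fst z))"
    using continuous_map_compose[OF continuous_map_fst continuous_inv] by (simp add: o_def)
  have "continuous_map (prod_topology T T) T ((\<lambda>(x, y). x \<otimes> y) \<circ> (\<lambda>z. ((\<lambda>(x, y). x \<otimes> y) z, inv (fst z))))"
    by (rule continuous_map_compose[OF _ continuous_mult])
      (use i continuous_mult in \<open>simp add: continuous_map_paired\<close>)
  then show ?thesis by (simp add: o_def split_def)
qed

end

context profinite_group
begin

text \<open>In a locally compact Hausdorff space a compact component has a basis of clopen neighbourhoods; here the
component of \<open>\<one>\<close> is a point.\<close>

lemma clopen_nbhd_of_one:
  assumes "openin T W" "\<one> \<in> W"
  obtains U where "openin T U" "closedin T U" "\<one> \<in> U" "U \<subseteq> W"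
proof -
  have one: "\<one> \<in> topspace T" by (simp add: topspace_eq_carrier)
  have "connected_component_of_set T \<one> = {\<one>}"
    using totally_disconnected[OF one] connected_component_of_refl[of T \<one>] one by auto
  then have C: "{\<one>} \<in> connected_components_of T"
    using one unfolding connected_components_of_def by (metis imageI)
  have lc: "locally_compact_space T" using compact by (rule compact_imp_locally_compact_space)
  have cp: "compactin T {\<one>}" using one by (simp add: compactin_sing)
  obtain U V where U: "openin T U" "openin T V" "disjnt U V" "U \<union> V = topspace T" "{\<one>} \<subseteq> U" "U \<subseteq> W"
    using wilder_locally_compact_component_thm[OF lc Hausdorff C cp assms(1)] assms(2) by blast
  have "U = topspace T - V" using U unfolding disjnt_def by blast
  then have "closedin T U" using U(2) by auto
  then show thesis using that U by blast
qed

text \<open>Take a clopen \<open>U\<close> with \<open>\<one> \<in> U \<subseteq> W\<close>. The elements \<open>g\<close> with \<open>U #> g = U\<close> form an open subgroup \<open>H\<close>, and \<open>H \<subseteq> U\<close>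
because \<open>\<one> \<in> U\<close>. Compactness of \<open>G\<close> makes the intersection of all conjugates of \<open>H\<close> open as well.\<close>

theorem open_normal_basis:
  assumes "openin T W" "\<one> \<in> W"
  shows "\<exists>N. N \<lhd> G \<and> openin T N \<and> N \<subseteq> W"
proof -
  obtain U where U: "openin T U" "closedin T U" "\<one> \<in> U" "U \<subseteq> W"
    using clopen_nbhd_of_one[OF assms] .
  have UG: "U \<subseteq> carrier G" using openin_subset[OF U(1)] by (simp add: topspace_eq_carrier)
  \<comment> \<open>Only a monoid; \<open>H\<close> below consists of its invertible elements.\<close>
  define S where "S = {g \<in> carrier G. \<forall>u\<in>U. u \<otimes> g \<in> U}"
  have "openin T S"
    unfolding S_def using open_transporter[OF compact continuous_mult U(2,1)] by simp
  define H where "H = S \<inter> {g \<in> topspace T. inv g \<in> S}"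
  have openH: "openin T H" unfolding H_def
    using \<open>openin T S\<close> openin_continuous_map_preimage[OF continuous_inv \<open>openin T S\<close>] by (rule openin_Int)
  have SU: "S \<subseteq> U"
  proof
    fix g assume "g \<in> S"
    then have "\<one> \<otimes> g \<in> U" "g \<in> carrier G" using U(3) unfolding S_def by blast+
    then show "g \<in> U" by simp
  qed
  have S1: "\<one> \<in> S" unfolding S_def using UG by (auto simp: subset_iff)
  have Sm: "a \<otimes> b \<in> S" if "a \<in> S" "b \<in> S" for a b
  proof -
    have ab: "a \<in> carrier G" "b \<in> carrier G" using that unfolding S_def by blast+
    have "u \<otimes> (a \<otimes> b) \<in> U" if u: "u \<in> U" for u
    proof -
      have "u \<otimes> a \<otimes> b \<in> U" using u \<open>a \<in> S\<close> \<open>b \<in> S\<close> unfolding S_def by blast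
      then show ?thesis using u UG ab by (simp add: m_assoc subset_iff)
    qed
    then show ?thesis using ab unfolding S_def by simp
  qed
  have Hcar: "H \<subseteq> carrier G" unfolding H_def S_def by blast
  have H: "subgroup H G"
  proof (rule subgroupI)
    show "H \<subseteq> carrier G" by (rule Hcar)
    have "\<one> \<in> H" unfolding H_def using S1 by (simp add: topspace_eq_carrier)
    then show "H \<noteq> {}" by blast
  next
    fix a assume "a \<in> H"
    then show "inv a \<in> H" using Hcar unfolding H_def by (auto simp: topspace_eq_carrier)
  next
    fix a b assume "a \<in> H" "b \<in> H"
    then show "a \<otimes> b \<in> H" using Sm unfolding H_def by (simp add: topspace_eq_carrier inv_mult_group)
  qed
  \<comment> \<open>The largest normal subgroup inside \<open>H\<close>.\<close>
  define N where "N = {g \<in> carrier G. \<forall>x\<in>carrier G. x \<otimes> g \<otimes> inv x \<in> H}"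
  have "closedin T (carrier G)" unfolding topspace_eq_carrier[symmetric] by simp
  then have openN: "openin T N"
    unfolding N_def using open_transporter[OF compact continuous_conjugation _ openH] by simp
  have NI: "x \<otimes> g \<otimes> inv x \<in> H" if "g \<in> N" "x \<in> carrier G" for x g using that unfolding N_def by blast
  have NG: "N \<subseteq> carrier G" unfolding N_def by blast
  interpret H: subgroup H G by (rule H)
  have NH: "N \<subseteq> H"
  proof
    fix g assume g: "g \<in> N"
    then show "g \<in> H" using NI[OF g one_closed] NG by auto
  qed
  have subN: "subgroup N G"
  proof (rule subgroupI)
    show "N \<subseteq> carrier G" by (rule NG)
    have "\<one> \<in> N" unfolding N_def by simp
    then show "N \<noteq> {}" by blast
  next
    fix a assume a: "a \<in> N"
    have "x \<otimes> inv a \<otimes> inv x \<in> H" if x: "x \<in> carrier G" for x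
    proof -
      have "x \<otimes> inv a \<otimes> inv x = inv (x \<otimes> a \<otimes> inv x)"
        using a NG x by (simp add: inv_mult_group m_assoc subset_iff)
      then show ?thesis using NI[OF a x] by simp
    qed
    then show "inv a \<in> N" using a NG unfolding N_def by blast
  next
    fix a b assume a: "a \<in> N" and b: "b \<in> N"
    have ab: "a \<in> carrier G" "b \<in> carrier G" using a b NG by blast+
    have "x \<otimes> (a \<otimes> b) \<otimes> inv x \<in> H" if x: "x \<in> carrier G" for x
    proof -
      have "x \<otimes> (a \<otimes> b) \<otimes> inv x = (x \<otimes> a \<otimes> inv x) \<otimes> (x \<otimes> b \<otimes> inv x)"
        using ab x by (simp add: m_assoc inv_mult_cancel_left)
      then show ?thesis using NI[OF a x] NI[OF b x] by simp
    qed
    then show "a \<otimes> b \<in> N" using ab unfolding N_def by blast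
  qed
  have "N \<lhd> G" unfolding normal_inv_iff
  proof (intro conjI ballI subN)
    fix y g assume y: "y \<in> carrier G" and g: "g \<in> N"
    have gG: "g \<in> carrier G" using g NG by blast
    have "x \<otimes> (y \<otimes> g \<otimes> inv y) \<otimes> inv x \<in> H" if x: "x \<in> carrier G" for x
    proof -
      have "x \<otimes> (y \<otimes> g \<otimes> inv y) \<otimes> inv x = (x \<otimes> y) \<otimes> g \<otimes> inv (x \<otimes> y)"
        using x y gG by (simp add: m_assoc inv_mult_group)
      then show ?thesis using NI[OF g, of "x \<otimes> y"] x y by simp
    qed
    then show "y \<otimes> g \<otimes> inv y \<in> N" using y gG unfolding N_def by blast
  qed
  moreover have "N \<subseteq> W" using NH SU U(4) unfolding H_def by blast
  ultimately show ?thesis using openN by blast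
qed

lemma finite_quotient:
  assumes "N \<lhd> G" "openin T N"
  shows "finite (carrier (G Mod N))" "group_hom G (G Mod N) (\<lambda>x. N #> x)"
    "carrier (G Mod N) = rcosets N"
proof -
  interpret N: normal N G by fact
  show "carrier (G Mod N) = rcosets N" by (simp add: FactGroup_def)
  then show "finite (carrier (G Mod N))"
    using open_subgroup_finite_index[OF compact N.subgroup_axioms assms(2)] by simp
  show "group_hom G (G Mod N) (\<lambda>x. N #> x)"
    using N.factorgroup_is_group N.r_coset_hom_Mod is_group
    by (simp add: group_hom_def group_hom_axioms_def)
qed

lemma preimage_quotient_eq_Union:
  assumes "N \<lhd> G" "A \<subseteq> carrier (G Mod N)"
  shows "{x \<in> carrier G. N #> x \<in> A} = \<Union>A"
proof -
  interpret N: normal N G by fact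
  have A: "A \<subseteq> rcosets N" using assms(2) by (simp add: FactGroup_def)
  show ?thesis
  proof (intro equalityI subsetI)
    fix x assume x: "x \<in> {x \<in> carrier G. N #> x \<in> A}"
    then have "x \<in> N #> x" using rcos_self[OF _ N.subgroup_axioms, of x] by simp
    then show "x \<in> \<Union>A" using x by auto
  next
    fix x assume "x \<in> \<Union>A"
    then obtain C where C: "C \<in> A" "x \<in> C" by blast
    then obtain y where y: "y \<in> carrier G" "C = N #> y" using A by (auto simp: RCOSETS_def)
    have x: "x \<in> carrier G" using C(2) y r_coset_subset_G[OF N.subset] by blast
    have "N #> y = N #> x"
      using repr_independence[OF _ y(1) N.subgroup_axioms, of x] C(2) unfolding y(2) by simp
    then show "x \<in> {x \<in> carrier G. N #> x \<in> A}" using x C(1) y(2) by simp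
  qed
qed

lemma clopen_preimage_quotient:
  assumes "N \<lhd> G" "openin T N" "A \<subseteq> carrier (G Mod N)"
  shows "openin T {x \<in> carrier G. N #> x \<in> A}" "closedin T {x \<in> carrier G. N #> x \<in> A}"
  unfolding preimage_quotient_eq_Union[OF assms(1,3)]
  using openin_Union_cosets[OF assms(2)] closedin_Union_cosets[OF normal_imp_subgroup[OF assms(1)] assms(2)]
    assms(3) by (simp_all add: FactGroup_def)

lemma profinite_closed_subgroup:
  assumes H: "subgroup H G" "closedin T H"
  shows "profinite_group (G\<lparr>carrier := H\<rparr>) (subtopology T H)"
proof -
  interpret H: subgroup H G by fact
  interpret HG: group "G\<lparr>carrier := H\<rparr>" using H(1) by (rule subgroup_imp_group)
  have tops: "topspace (subtopology T H) = H"
    using closedin_subset[OF H(2)] by (simp add: Int_absorb1)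
  have mult: "continuous_map (prod_topology (subtopology T H) (subtopology T H)) (subtopology T H)
      (\<lambda>(x, y). x \<otimes>\<^bsub>G\<lparr>carrier := H\<rparr>\<^esub> y)"
    unfolding prod_topology_subtopology(1) prod_topology_subtopology(2)
    using continuous_map_from_subtopology[OF continuous_map_from_subtopology[OF continuous_mult]]
    by (auto simp: continuous_map_in_subtopology split_def image_subset_iff)
  have "continuous_map (subtopology T H) T (\<lambda>x. inv x)"
    using continuous_inv by (rule continuous_map_from_subtopology)
  then have "continuous_map (subtopology T H) (subtopology T H) (\<lambda>x. inv x)"
    by (auto simp: continuous_map_in_subtopology)
  then have inv: "continuous_map (subtopology T H) (subtopology T H) (\<lambda>x. inv\<^bsub>G\<lparr>carrier := H\<rparr>\<^esub> x)"
    by (rule continuous_map_eq) (use H(1) in \<open>simp add: m_inv_consistent\<close>)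
  have comp: "compact_space (subtopology T H)"
    using closedin_compact_space[OF compact H(2)] by (rule compact_space_subtopology)
  have Haus: "Hausdorff_space (subtopology T H)" using Hausdorff by (rule Hausdorff_space_subtopology)
  have td: "x = y" if "x \<in> topspace (subtopology T H)" "connected_component_of (subtopology T H) x y" for x y
  proof -
    have "connected_component_of T x y"
      using that(2) unfolding connected_component_of_def connectedin_subtopology by blast
    then show ?thesis using totally_disconnected that(1) by auto
  qed
  show ?thesis
    by unfold_locales (use tops mult inv comp Haus td in auto)
qed

lemma p_sized_quotient_image_iff:
  assumes p: "Factorial_Ring.prime p" and N: "N \<lhd> G" "openin T N" and H: "subgroup H G"
  shows "p_sized p ((\<lambda>x. N #> x) ` H) \<longleftrightarrow> (\<forall>x\<in>H. \<exists>n::nat. x [^] (p ^ n) \<in> N)"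
proof -
  interpret N: normal N G by fact
  interpret H: subgroup H G by fact
  interpret GN: group_hom G "G Mod N" "\<lambda>x. N #> x" using finite_quotient(2)[OF N] .
  have "(N #> x) [^]\<^bsub>G Mod N\<^esub> k = \<one>\<^bsub>G Mod N\<^esub> \<longleftrightarrow> x [^] k \<in> N" if x: "x \<in> H" for x and k :: nat
  proof -
    have "x [^] k \<in> carrier G" using x by simp
    then have "N #> (x [^] k) = N \<longleftrightarrow> x [^] k \<in> N"
      using rcos_self[OF _ N.subgroup_axioms] N.rcos_const[OF is_group] by metis
    then show ?thesis using N.FactGroup_pow[of x k] x by simp
  qed
  then show ?thesis
    using GN.H.p_sized_iff_elements[OF finite_quotient(1)[OF N] p GN.subgroup_img_is_subgroup[OF H]]
    by simp
qed

text \<open>Tests a subgroup on the open normal subgroups of \<open>G\<close> instead of its own. The two families are cofinal: an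
open subgroup of \<open>H\<close> is \<open>U \<inter> H\<close> with \<open>U\<close> open in \<open>G\<close>, and \<open>U\<close> contains an open normal subgroup of \<open>G\<close>.\<close>

theorem pro_p_subgroup_iff:
  assumes p: "Factorial_Ring.prime p"
  shows "pro_p_subgroup H G T p \<longleftrightarrow> subgroup H G \<and> closedin T H \<and>
    (\<forall>N. N \<lhd> G \<and> openin T N \<longrightarrow> p_sized p ((\<lambda>x. N #> x) ` H))" (is "?L \<longleftrightarrow> ?R")
proof
  assume L: ?L
  have H: "subgroup H G" using L unfolding pro_p_subgroup_def by blast
  interpret HG: profinite_group "G\<lparr>carrier := H\<rparr>" "subtopology T H"
    using L unfolding pro_p_subgroup_def pro_p_group_def by blast
  interpret H: subgroup H G by fact
  have "compactin T H"
    using HG.compact H.subset by (simp add: compactin_subspace topspace_eq_carrier)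
  then have "closedin T H" using Hausdorff compactin_imp_closedin by blast
  moreover have "p_sized p ((\<lambda>x. N #> x) ` H)" if N: "N \<lhd> G" "openin T N" for N
  proof -
    interpret N: normal N G by fact
    have NH: "N \<inter> H \<lhd> G\<lparr>carrier := H\<rparr>"
      using normal_Int_subgroup[OF H N(1)] .
    have "openin (subtopology T H) (N \<inter> H)" using N(2) by (auto simp: openin_subtopology)
    then have "finite_p_group ((G\<lparr>carrier := H\<rparr>) Mod (N \<inter> H)) p"
      using L NH unfolding pro_p_subgroup_def pro_p_group_def by blast
    then have "p_sized p ((\<lambda>x. (N \<inter> H) #> x) ` H)"
      unfolding finite_p_group_def p_sized_def by (auto simp: carrier_FactGroup)
    moreover have "card ((\<lambda>x. (N \<inter> H) #> x) ` H) = card ((\<lambda>x. N #> x) ` H)"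
    proof (rule card_image_cong_kernel)
      fix x y assume xy: "x \<in> H" "y \<in> H"
      have sub: "subgroup (N \<inter> H) G"
        using subgroups_Inter_pair[OF N.subgroup_axioms H] .
      have key: "K #> x = K #> y \<longleftrightarrow> x \<otimes> inv y \<in> K" if K: "subgroup K G" for K
      proof -
        have "K #> x = K #> y \<longleftrightarrow> x \<in> K #> y"
          using repr_independence[OF _ _ K, of x y] rcos_self[OF _ K, of x] xy by auto
        also have "\<dots> \<longleftrightarrow> x \<otimes> inv y \<in> K"
          using subgroup.rcos_module[OF K is_group] xy by auto
        finally show ?thesis .
      qed
      show "(N \<inter> H) #> x = (N \<inter> H) #> y \<longleftrightarrow> N #> x = N #> y"
        unfolding key[OF sub] key[OF N.subgroup_axioms] using xy by auto
    qed
    ultimately show ?thesis unfolding p_sized_def by simp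
  qed
  ultimately show ?R using H by blast
next
  assume R: ?R
  then have H: "subgroup H G" "closedin T H" by blast+
  interpret H: subgroup H G by fact
  interpret HG: profinite_group "G\<lparr>carrier := H\<rparr>" "subtopology T H"
    using H by (rule profinite_closed_subgroup)
  have "finite_p_group ((G\<lparr>carrier := H\<rparr>) Mod K) p"
    if K: "K \<lhd> G\<lparr>carrier := H\<rparr>" "openin (subtopology T H) K" for K
  proof -
    interpret K: normal K "G\<lparr>carrier := H\<rparr>" by fact
    interpret Q: group "(G\<lparr>carrier := H\<rparr>) Mod K" by (rule K.factorgroup_is_group)
    obtain U where U: "openin T U" "K = U \<inter> H" using K(2) by (auto simp: openin_subtopology)
    have "\<one> \<in> U" using K.one_closed U(2) by auto
    then obtain N where N: "N \<lhd> G" "openin T N" "N \<subseteq> U" using open_normal_basis[OF U(1)] by blast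
    interpret N: normal N G by fact
    have fin: "finite (carrier ((G\<lparr>carrier := H\<rparr>) Mod K))" using HG.finite_quotient(1)[OF K] .
    have pH: "p_sized p ((\<lambda>x. N #> x) ` H)" using R N by blast
    have el: "\<exists>n::nat. C [^]\<^bsub>(G\<lparr>carrier := H\<rparr>) Mod K\<^esub> (p ^ n) = \<one>\<^bsub>(G\<lparr>carrier := H\<rparr>) Mod K\<^esub>"
      if C: "C \<in> carrier ((G\<lparr>carrier := H\<rparr>) Mod K)" for C
    proof -
      obtain x where x: "x \<in> H" "C = K #>\<^bsub>G\<lparr>carrier := H\<rparr>\<^esub> x" using C by (auto simp: carrier_FactGroup)
      obtain n :: nat where "x [^] (p ^ n) \<in> N"
        using pH x(1) unfolding p_sized_quotient_image_iff[OF p N(1,2) H(1)] by blast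
      moreover have pw: "x [^] k \<in> H" for k :: nat using x(1) by (induction k) auto
      ultimately have xK: "x [^] (p ^ n) \<in> K" using N(3) U(2) by blast
      have "C [^]\<^bsub>(G\<lparr>carrier := H\<rparr>) Mod K\<^esub> (p ^ n) = K #>\<^bsub>G\<lparr>carrier := H\<rparr>\<^esub> (x [^]\<^bsub>G\<lparr>carrier := H\<rparr>\<^esub> (p ^ n))"
        using K.FactGroup_pow[of x "p ^ n"] x by simp
      also have "\<dots> = K"
        using K.rcos_const[OF HG.is_group xK] nat_pow_consistent[of x "p ^ n" H] by simp
      finally have "C [^]\<^bsub>(G\<lparr>carrier := H\<rparr>) Mod K\<^esub> (p ^ n) = \<one>\<^bsub>(G\<lparr>carrier := H\<rparr>) Mod K\<^esub>" by simp
      then show ?thesis by blast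
    qed
    have "p_sized p (carrier ((G\<lparr>carrier := H\<rparr>) Mod K))"
      using Q.p_sized_iff_elements[OF fin p Q.subgroup_self] el by blast
    then show ?thesis using fin Q.is_group unfolding finite_p_group_def p_sized_def by blast
  qed
  then show ?L using H(1) HG.profinite_group_axioms unfolding pro_p_subgroup_def pro_p_group_def by blast
qed

lemma top_generate_closed_subgroup:
  assumes "S \<subseteq> carrier G"
  shows "subgroup (top_generate G T S) G" "closedin T (top_generate G T S)" "S \<subseteq> top_generate G T S"
proof -
  define F where "F = {H. (subgroup H G \<and> closedin T H) \<and> S \<subseteq> H}"
  have eq: "top_generate G T S = \<Inter>F" unfolding top_generate_def hull_def F_def by (rule refl)
  have "closedin T (carrier G)" unfolding topspace_eq_carrier[symmetric] by simp
  then have "carrier G \<in> F" using subgroup_self assms unfolding F_def by simp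
  then have ne: "F \<noteq> {}" by blast
  show "subgroup (top_generate G T S) G"
    unfolding eq by (rule subgroups_Inter[OF _ ne]) (simp add: F_def)
  show "closedin T (top_generate G T S)"
    unfolding eq by (rule closedin_Inter[OF ne]) (simp add: F_def)
  show "S \<subseteq> top_generate G T S" unfolding top_generate_def by (rule hull_subset)
qed

text \<open>The preimage of a subgroup of the finite quotient is clopen, so it contains the closed subgroup generated
by \<open>S\<close> as soon as it contains \<open>S\<close>. Passing to topological closures is thus invisible in the quotient.\<close>

lemma quotient_image_top_generate:
  assumes N: "N \<lhd> G" "openin T N" and S: "S \<subseteq> carrier G"
  shows "(\<lambda>x. N #> x) ` top_generate G T S = generate (G Mod N) ((\<lambda>x. N #> x) ` S)"
proof
  interpret N: normal N G by fact
  interpret GN: group_hom G "G Mod N" "\<lambda>x. N #> x" using finite_quotient(2)[OF N] .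
  let ?g = "generate (G Mod N) ((\<lambda>x. N #> x) ` S)"
  have im: "(\<lambda>x. N #> x) ` S \<subseteq> carrier (G Mod N)" using S GN.hom_closed by blast
  have g: "subgroup ?g (G Mod N)" using GN.H.generate_is_subgroup[OF im] .
  show "?g \<subseteq> (\<lambda>x. N #> x) ` top_generate G T S"
    using top_generate_closed_subgroup[OF S]
    by (intro GN.H.generate_subgroup_incl GN.subgroup_img_is_subgroup) auto
  let ?P = "{x \<in> carrier G. N #> x \<in> ?g}"
  have "closedin T ?P" using clopen_preimage_quotient(2)[OF N subgroup.subset[OF g]] .
  moreover have "subgroup ?P G"
  proof (rule subgroupI)
    have "\<one> \<in> ?P" using subgroup.one_closed[OF g] GN.hom_one by simp
    then show "?P \<noteq> {}" by blast
  next
    fix a assume a: "a \<in> ?P"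
    then have "inv\<^bsub>G Mod N\<^esub> (N #> a) \<in> ?g" using subgroup.m_inv_closed[OF g] by blast
    then show "inv a \<in> ?P" using a GN.hom_inv by simp
  next
    fix a b assume a: "a \<in> ?P" and b: "b \<in> ?P"
    then have "(N #> a) \<otimes>\<^bsub>G Mod N\<^esub> (N #> b) \<in> ?g" using subgroup.m_closed[OF g] by blast
    moreover have "N #> (a \<otimes> b) = (N #> a) \<otimes>\<^bsub>G Mod N\<^esub> (N #> b)" using a b GN.hom_mult by blast
    ultimately show "a \<otimes> b \<in> ?P" using a b by simp
  qed blast
  moreover have "S \<subseteq> ?P"
  proof
    fix s assume s: "s \<in> S"
    then have "N #> s \<in> ?g" by (intro generate.incl imageI)
    then show "s \<in> ?P" using s S by blast
  qed
  ultimately have "top_generate G T S \<subseteq> ?P"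
    unfolding top_generate_def by (intro hull_minimal) auto
  then show "(\<lambda>x. N #> x) ` top_generate G T S \<subseteq> ?g" by blast
qed

lemma pro_p_top_generate_iff:
  assumes p: "Factorial_Ring.prime p" and S: "S \<subseteq> carrier G"
  shows "pro_p_subgroup (top_generate G T S) G T p \<longleftrightarrow>
    (\<forall>N. N \<lhd> G \<and> openin T N \<longrightarrow> p_sized p (generate (G Mod N) ((\<lambda>x. N #> x) ` S)))"
  unfolding pro_p_subgroup_iff[OF p]
  by (simp add: top_generate_closed_subgroup[OF S] quotient_image_top_generate[OF _ _ S])

lemma p_element_iff:
  "p_element G T p g \<longleftrightarrow> g \<in> carrier G \<and>
    (\<forall>N. N \<lhd> G \<and> openin T N \<longrightarrow> p_sized p (generate (G Mod N) {N #> g}))"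
proof (cases "g \<in> carrier G")
  case True
  have *: "finite_p_group ((G Mod N)\<lparr>carrier := (\<lambda>x. N #> x) ` top_generate G T {g}\<rparr>) p \<longleftrightarrow>
      p_sized p (generate (G Mod N) {N #> g})" if N: "N \<lhd> G" "openin T N" for N
  proof -
    interpret GN: group_hom G "G Mod N" "\<lambda>x. N #> x" using finite_quotient(2)[OF N] .
    have eq: "(\<lambda>x. N #> x) ` top_generate G T {g} = generate (G Mod N) {N #> g}"
      using quotient_image_top_generate[OF N, of "{g}"] True by simp
    have sub: "subgroup (generate (G Mod N) {N #> g}) (G Mod N)"
      using True by (intro GN.H.generate_is_subgroup) auto
    have "finite (generate (G Mod N) {N #> g})"
      using finite_quotient(1)[OF N] subgroup.subset[OF sub] finite_subset by blast
    then show ?thesis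
      unfolding eq finite_p_group_def p_sized_def using GN.H.subgroup_imp_group[OF sub] by simp
  qed
  show ?thesis unfolding p_element_def using True by (simp add: *)
qed (simp add: p_element_def)

lemma Omega_at_iff:
  assumes p: "Factorial_Ring.prime p" and g: "g \<in> carrier G"
  shows "x \<in> Omega_at G T p g \<longleftrightarrow> x \<in> carrier G \<and>
    (\<forall>N. N \<lhd> G \<and> openin T N \<longrightarrow> p_sized p (generate (G Mod N) {N #> x, N #> g}))"
proof (cases "x \<in> carrier G")
  case True
  then show ?thesis
    unfolding Omega_at_def using pro_p_top_generate_iff[OF p, of "{x, g}"] g by simp
qed (simp add: Omega_at_def)

end

section \<open>The p-core\<close>

lemma (in group) p_sized_generate_conj:
  assumes c: "c \<in> carrier G" and S: "S \<subseteq> carrier G"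
  shows "p_sized p (generate G ((\<lambda>s. c \<otimes> s \<otimes> inv c) ` S)) \<longleftrightarrow> p_sized p (generate G S)"
proof -
  interpret conj: group_hom G G "\<lambda>s. c \<otimes> s \<otimes> inv c"
  proof
    show "(\<lambda>s. c \<otimes> s \<otimes> inv c) \<in> hom G G"
      using c by (intro homI) (auto simp: m_assoc inv_mult_cancel_left)
  qed
  have "inj_on (\<lambda>s. c \<otimes> s \<otimes> inv c) (generate G S)"
    using c generate_in_carrier[OF S] by (intro inj_onI) simp
  then show ?thesis unfolding conj.generate_img[OF S] p_sized_def by (simp add: card_image)
qed

locale profinite_group_prime = profinite_group +
  fixes p :: nat
  assumes prime: "Factorial_Ring.prime p"
begin

text \<open>The intersection whose measure is compared with the index of the p-core. It turns out to be the p-core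
itself, see \<open>p_core_eq_p_joint_set\<close>.\<close>

definition p_joint_set :: "'a set" where
  "p_joint_set = (\<Inter>g\<in>p_elements G T p. Omega_at G T p g)"

lemma one_p_element: "p_element G T p \<one>"
  unfolding p_element_iff
proof (intro conjI allI impI)
  fix N assume N: "N \<lhd> G \<and> openin T N"
  interpret GN: group_hom G "G Mod N" "\<lambda>x. N #> x" using finite_quotient(2) N by blast
  show "p_sized p (generate (G Mod N) {N #> \<one>})"
    unfolding GN.hom_one GN.H.generate_one p_sized_def by (intro exI[of _ 0]) simp
qed simp

lemma p_joint_set_iff:
  "x \<in> p_joint_set \<longleftrightarrow> x \<in> carrier G \<and>
    (\<forall>g N. p_element G T p g \<longrightarrow> N \<lhd> G \<longrightarrow> openin T N \<longrightarrow>
      p_sized p (generate (G Mod N) {N #> x, N #> g}))"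
proof -
  have gG: "g \<in> carrier G" if "p_element G T p g" for g using that unfolding p_element_def by blast
  have "x \<in> p_joint_set \<longleftrightarrow> (\<forall>g. p_element G T p g \<longrightarrow> x \<in> Omega_at G T p g)"
    unfolding p_joint_set_def p_elements_def by blast
  also have "\<dots> \<longleftrightarrow> (\<forall>g. p_element G T p g \<longrightarrow> x \<in> carrier G \<and>
     (\<forall>N. N \<lhd> G \<and> openin T N \<longrightarrow> p_sized p (generate (G Mod N) {N #> x, N #> g})))"
    using Omega_at_iff[OF prime gG] by simp
  also have "\<dots> \<longleftrightarrow> x \<in> carrier G \<and> (\<forall>g N. p_element G T p g \<longrightarrow> N \<lhd> G \<longrightarrow> openin T N \<longrightarrow>
      p_sized p (generate (G Mod N) {N #> x, N #> g}))"
    using one_p_element by metis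
  finally show ?thesis .
qed

lemma p_joint_set_carrier: "p_joint_set \<subseteq> carrier G"
  using p_joint_set_iff by blast

text \<open>The set \<open>S\<close> may depend on \<open>N\<close>; it serves for p-groups generated by the image of \<open>x\<close> and further elements.\<close>

lemma p_elementI:
  assumes x: "x \<in> carrier G" and S: "\<And>N. N \<lhd> G \<Longrightarrow> openin T N \<Longrightarrow>
     \<exists>S. S \<subseteq> carrier (G Mod N) \<and> N #> x \<in> S \<and> p_sized p (generate (G Mod N) S)"
  shows "p_element G T p x"
  unfolding p_element_iff
proof (intro conjI allI impI x)
  fix N assume N: "N \<lhd> G \<and> openin T N"
  interpret GN: group_hom G "G Mod N" "\<lambda>x. N #> x" using finite_quotient(2) N by blast
  obtain S where S: "S \<subseteq> carrier (G Mod N)" "N #> x \<in> S" "p_sized p (generate (G Mod N) S)"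
    using S N by blast
  have fin: "finite (carrier (G Mod N))" using finite_quotient(1) N by blast
  have sub: "subgroup (generate (G Mod N) {N #> x}) (G Mod N)"
    using x by (intro GN.H.generate_is_subgroup) auto
  have "generate (G Mod N) {N #> x} \<subseteq> generate (G Mod N) S"
    using S(2) by (intro GN.H.mono_generate) blast
  then show "p_sized p (generate (G Mod N) {N #> x})"
    using GN.H.p_sized_subgroup[OF fin prime GN.H.generate_is_subgroup[OF S(1)] sub _ S(3)] by blast
qed

lemma p_joint_set_p_element:
  assumes "x \<in> p_joint_set"
  shows "p_element G T p x"
proof (rule p_elementI)
  show x: "x \<in> carrier G" using assms p_joint_set_carrier by blast
  fix N assume N: "N \<lhd> G" "openin T N"
  interpret GN: group_hom G "G Mod N" "\<lambda>x. N #> x" using finite_quotient(2)[OF N] .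
  have "p_sized p (generate (G Mod N) {N #> x, N #> \<one>})"
    using assms N one_p_element unfolding p_joint_set_iff by blast
  then show "\<exists>S. S \<subseteq> carrier (G Mod N) \<and> N #> x \<in> S \<and> p_sized p (generate (G Mod N) S)"
    using x GN.hom_closed[OF x] GN.hom_closed[OF one_closed]
    by (intro exI[of _ "{N #> x, N #> \<one>}"]) blast
qed

lemma p_joint_set_pair:
  assumes "x \<in> p_joint_set" "y \<in> p_joint_set" "N \<lhd> G" "openin T N"
  shows "p_sized p (generate (G Mod N) {N #> x, N #> y})"
  using assms p_joint_set_p_element[OF assms(2)] unfolding p_joint_set_iff[of x] by blast

lemma quotient_conj:
  assumes "N \<lhd> G" "c \<in> carrier G" "x \<in> carrier G"
  shows "N #> (c \<otimes> x \<otimes> inv c) = (N #> c) \<otimes>\<^bsub>G Mod N\<^esub> (N #> x) \<otimes>\<^bsub>G Mod N\<^esub> inv\<^bsub>G Mod N\<^esub> (N #> c)"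
proof -
  interpret N: normal N G by fact
  interpret GN: group_hom G "G Mod N" "\<lambda>x. N #> x"
    using N.factorgroup_is_group N.r_coset_hom_Mod is_group
    by (simp add: group_hom_def group_hom_axioms_def)
  show ?thesis using assms(2,3) by (simp only: GN.hom_mult GN.hom_inv m_closed inv_closed)
qed

lemma p_sized_generate_quotient_conj:
  assumes N: "N \<lhd> G" "openin T N" and c: "c \<in> carrier G" and S: "S \<subseteq> carrier G"
  shows "p_sized p (generate (G Mod N) ((\<lambda>s. N #> (c \<otimes> s \<otimes> inv c)) ` S)) \<longleftrightarrow>
    p_sized p (generate (G Mod N) ((\<lambda>s. N #> s) ` S))"
proof -
  interpret GN: group_hom G "G Mod N" "\<lambda>x. N #> x" using finite_quotient(2)[OF N] .
  let ?c = "\<lambda>s. (N #> c) \<otimes>\<^bsub>G Mod N\<^esub> s \<otimes>\<^bsub>G Mod N\<^esub> inv\<^bsub>G Mod N\<^esub> (N #> c)"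
  have "(\<lambda>s. N #> (c \<otimes> s \<otimes> inv c)) ` S = ?c ` ((\<lambda>s. N #> s) ` S)"
    unfolding image_image using quotient_conj[OF N(1) c] S by (intro image_cong) auto
  moreover have "(\<lambda>s. N #> s) ` S \<subseteq> carrier (G Mod N)" using S GN.hom_closed by blast
  ultimately show ?thesis
    using GN.H.p_sized_generate_conj[OF GN.hom_closed[OF c]] by simp
qed

lemma p_element_conj:
  assumes "p_element G T p g" "c \<in> carrier G"
  shows "p_element G T p (c \<otimes> g \<otimes> inv c)"
proof -
  have g: "g \<in> carrier G" using assms(1) unfolding p_element_def by blast
  show ?thesis
    using assms p_sized_generate_quotient_conj[of _ c "{g}"] g unfolding p_element_iff by simp
qed

lemma p_joint_set_conj:
  assumes x: "x \<in> p_joint_set" and c: "c \<in> carrier G"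
  shows "c \<otimes> x \<otimes> inv c \<in> p_joint_set"
  unfolding p_joint_set_iff
proof (intro conjI allI impI)
  have xG: "x \<in> carrier G" using x p_joint_set_carrier by blast
  then show "c \<otimes> x \<otimes> inv c \<in> carrier G" using c by simp
  fix g N assume g: "p_element G T p g" and N: "N \<lhd> G" "openin T N"
  have gG: "g \<in> carrier G" using g unfolding p_element_def by blast
  let ?g = "inv c \<otimes> g \<otimes> c"
  have "p_element G T p ?g" using p_element_conj[OF g inv_closed[OF c]] c by simp
  then have *: "p_sized p (generate (G Mod N) {N #> x, N #> ?g})"
    using x N unfolding p_joint_set_iff by blast
  have "c \<otimes> ?g \<otimes> inv c = g" using c gG by (simp add: m_assoc inv_mult_cancel_left)
  then show "p_sized p (generate (G Mod N) {N #> (c \<otimes> x \<otimes> inv c), N #> g})"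
    using p_sized_generate_quotient_conj[OF N c, of "{x, ?g}"] * xG gG c by simp
qed

text \<open>Members of the set are p-elements, so any two of them generate a p-group in the quotient, and Baer-Suzuki
applies to the image of the set.\<close>

lemma p_sized_generate_image_p_joint_set:
  assumes N: "N \<lhd> G" "openin T N"
  shows "p_sized p (generate (G Mod N) ((\<lambda>x. N #> x) ` p_joint_set))"
proof -
  interpret GN: group_hom G "G Mod N" "\<lambda>x. N #> x" using finite_quotient(2)[OF N] .
  show ?thesis
  proof (rule GN.H.Baer_Suzuki[OF finite_quotient(1)[OF N] prime])
    show "(\<lambda>x. N #> x) ` p_joint_set \<subseteq> carrier (G Mod N)"
      using p_joint_set_carrier GN.hom_closed by blast
  next
    fix C D assume "C \<in> carrier (G Mod N)" and "D \<in> (\<lambda>x. N #> x) ` p_joint_set"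
    then obtain c d where cd: "c \<in> carrier G" "C = N #> c" "d \<in> p_joint_set" "D = N #> d"
      unfolding carrier_FactGroup by blast
    have dG: "d \<in> carrier G" using cd(3) p_joint_set_carrier by blast
    show "C \<otimes>\<^bsub>G Mod N\<^esub> D \<otimes>\<^bsub>G Mod N\<^esub> inv\<^bsub>G Mod N\<^esub> C \<in> (\<lambda>x. N #> x) ` p_joint_set"
      using p_joint_set_conj[OF cd(3,1)] quotient_conj[OF N(1) cd(1) dG] unfolding cd(2,4) by (metis imageI)
  next
    fix C D assume "C \<in> (\<lambda>x. N #> x) ` p_joint_set" "D \<in> (\<lambda>x. N #> x) ` p_joint_set"
    then show "p_sized p (generate (G Mod N) {C, D})" using p_joint_set_pair[OF _ _ N] by auto
  qed
qed

lemma carrier_open_normal: "carrier G \<lhd> G" "openin T (carrier G)"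
  using normal_self by (auto simp flip: topspace_eq_carrier)

text \<open>The source of all closedness, and hence measurability, statements about subsets of \<open>G\<close>: conditions that
are imposed in every finite quotient define closed sets.\<close>

lemma closedin_all_quotients:
  assumes "\<And>N. N \<lhd> G \<Longrightarrow> openin T N \<Longrightarrow> A N \<subseteq> carrier (G Mod N)"
  shows "closedin T {x \<in> carrier G. \<forall>N. N \<lhd> G \<and> openin T N \<longrightarrow> N #> x \<in> A N}"
proof -
  let ?O = "{N. N \<lhd> G \<and> openin T N}"
  have "{x \<in> carrier G. \<forall>N. N \<lhd> G \<and> openin T N \<longrightarrow> N #> x \<in> A N}
    = (\<Inter>N\<in>?O. {x \<in> carrier G. N #> x \<in> A N})"
    using carrier_open_normal by blast
  moreover have "closedin T (\<Inter>N\<in>?O. {x \<in> carrier G. N #> x \<in> A N})"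
    using carrier_open_normal clopen_preimage_quotient(2) assms by (intro closedin_INT) auto
  ultimately show ?thesis by simp
qed

text \<open>The elements whose image lies in the subgroup generated by the image of \<open>p_joint_set\<close>, for every \<open>N\<close>,
form a closed normal subgroup, and its images are subgroups of p-groups.\<close>

lemma normal_pro_p_containing_p_joint_set:
  "\<exists>K. K \<lhd> G \<and> pro_p_subgroup K G T p \<and> p_joint_set \<subseteq> K"
proof -
  let ?gen = "\<lambda>N. generate (G Mod N) ((\<lambda>x. N #> x) ` p_joint_set)"
  define K where "K = {x \<in> carrier G. \<forall>N. N \<lhd> G \<and> openin T N \<longrightarrow> N #> x \<in> ?gen N}"
  have hom: "group_hom G (G Mod N) (\<lambda>x. N #> x)" if "N \<lhd> G" "openin T N" for N
    using finite_quotient(2)[OF that] .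
  have im: "(\<lambda>x. N #> x) ` p_joint_set \<subseteq> carrier (G Mod N)" if N: "N \<lhd> G" "openin T N" for N
    using p_joint_set_carrier group_hom.hom_closed[OF hom[OF N]] by blast
  have gen: "subgroup (?gen N) (G Mod N)" if N: "N \<lhd> G" "openin T N" for N
    using group.generate_is_subgroup[OF _ im[OF N]] group_hom.axioms(2)[OF hom[OF N]] by blast
  have "closedin T K"
    unfolding K_def by (rule closedin_all_quotients) (use gen subgroup.subset in blast)
  moreover have K: "subgroup K G"
  proof (rule subgroupI)
    have "N #> \<one> \<in> ?gen N" if N: "N \<lhd> G" "openin T N" for N
      using subgroup.one_closed[OF gen[OF N]] group_hom.hom_one[OF hom[OF N]] by simp
    then have "\<one> \<in> K" unfolding K_def by blast
    then show "K \<noteq> {}" by blast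
    show "K \<subseteq> carrier G" unfolding K_def by blast
  next
    fix a assume a: "a \<in> K"
    have "N #> inv a \<in> ?gen N" if N: "N \<lhd> G" "openin T N" for N
      using subgroup.m_inv_closed[OF gen[OF N]] group_hom.hom_inv[OF hom[OF N]] a N
      unfolding K_def by auto
    then show "inv a \<in> K" using a unfolding K_def by blast
  next
    fix a b assume a: "a \<in> K" and b: "b \<in> K"
    have "N #> (a \<otimes> b) \<in> ?gen N" if N: "N \<lhd> G" "openin T N" for N
    proof -
      have "(N #> a) \<otimes>\<^bsub>G Mod N\<^esub> (N #> b) \<in> ?gen N"
        using a b N subgroup.m_closed[OF gen[OF N]] unfolding K_def by blast
      moreover have "N #> (a \<otimes> b) = (N #> a) \<otimes>\<^bsub>G Mod N\<^esub> (N #> b)"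
        using a b group_hom.hom_mult[OF hom[OF N]] unfolding K_def by blast
      ultimately show ?thesis by simp
    qed
    then show "a \<otimes> b \<in> K" using a b unfolding K_def by blast
  qed
  moreover have "p_sized p ((\<lambda>x. N #> x) ` K)" if N: "N \<lhd> G" "openin T N" for N
  proof (rule group.p_sized_subgroup)
    show "group (G Mod N)" using group_hom.axioms(2)[OF hom[OF N]] .
    show "finite (carrier (G Mod N))" using finite_quotient(1)[OF N] .
    show "p_sized p (?gen N)" using p_sized_generate_image_p_joint_set[OF N] .
    show "subgroup ((\<lambda>x. N #> x) ` K) (G Mod N)" using group_hom.subgroup_img_is_subgroup[OF hom[OF N] K] .
    show "(\<lambda>x. N #> x) ` K \<subseteq> ?gen N" unfolding K_def using N by blast
  qed (use prime gen[OF N] in auto)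
  ultimately have "pro_p_subgroup K G T p" unfolding pro_p_subgroup_iff[OF prime] by blast
  moreover have "K \<lhd> G" unfolding normal_inv_iff
  proof (intro conjI ballI K)
    fix c k assume c: "c \<in> carrier G" and k: "k \<in> K"
    have kG: "k \<in> carrier G" using k unfolding K_def by blast
    have "N #> (c \<otimes> k \<otimes> inv c) \<in> ?gen N" if N: "N \<lhd> G" "openin T N" for N
      unfolding quotient_conj[OF N(1) c kG]
    proof (rule group.generate_conj_closed[OF group_hom.axioms(2)[OF hom[OF N]] im[OF N]])
      show "N #> c \<in> carrier (G Mod N)" using group_hom.hom_closed[OF hom[OF N] c] .
      show "N #> k \<in> ?gen N" using k N unfolding K_def by blast
      fix s assume "s \<in> (\<lambda>x. N #> x) ` p_joint_set"
      then obtain d where d: "d \<in> p_joint_set" "s = N #> d" by blast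
      have dG: "d \<in> carrier G" using d(1) p_joint_set_carrier by blast
      show "(N #> c) \<otimes>\<^bsub>G Mod N\<^esub> s \<otimes>\<^bsub>G Mod N\<^esub> inv\<^bsub>G Mod N\<^esub> (N #> c) \<in> (\<lambda>x. N #> x) ` p_joint_set"
        using p_joint_set_conj[OF d(1) c] quotient_conj[OF N(1) c dG] unfolding d(2) by (metis imageI)
    qed
    then show "c \<otimes> k \<otimes> inv c \<in> K" using c kG unfolding K_def by simp
  qed
  moreover have "p_joint_set \<subseteq> K"
  proof
    fix x assume x: "x \<in> p_joint_set"
    then have "N #> x \<in> ?gen N" for N by (intro generate.incl imageI)
    then show "x \<in> K" using x p_joint_set_carrier unfolding K_def by blast
  qed
  ultimately show ?thesis by blast
qed

text \<open>In a quotient, the image of \<open>L\<close> is a normal p-subgroup, so its product with the p-group generated by a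
p-element is again a p-group.\<close>

lemma normal_pro_p_subset_p_joint_set:
  assumes L: "L \<lhd> G" "pro_p_subgroup L G T p"
  shows "L \<subseteq> p_joint_set"
proof
  fix x assume x: "x \<in> L"
  interpret L: normal L G by fact
  have xG: "x \<in> carrier G" using x by simp
  show "x \<in> p_joint_set" unfolding p_joint_set_iff
  proof (intro conjI allI impI xG)
    fix g N assume g: "p_element G T p g" and N: "N \<lhd> G" "openin T N"
    interpret GN: group_hom G "G Mod N" "\<lambda>x. N #> x" using finite_quotient(2)[OF N] .
    have gG: "g \<in> carrier G" using g unfolding p_element_def by blast
    let ?L = "(\<lambda>x. N #> x) ` L" and ?g = "generate (G Mod N) {N #> g}"
    have fin: "finite (carrier (G Mod N))" using finite_quotient(1)[OF N] .
    have subL: "subgroup ?L (G Mod N)" using GN.subgroup_img_is_subgroup[OF L.subgroup_axioms] .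
    have subg: "subgroup ?g (G Mod N)" using gG by (intro GN.H.generate_is_subgroup) auto
    have pL: "p_sized p ?L" using L(2) N unfolding pro_p_subgroup_iff[OF prime] by blast
    have pg: "p_sized p ?g" using g N unfolding p_element_iff by blast
    have norm: "l \<otimes>\<^bsub>G Mod N\<^esub> h \<otimes>\<^bsub>G Mod N\<^esub> inv\<^bsub>G Mod N\<^esub> l \<in> ?L" if lh: "l \<in> ?g" "h \<in> ?L" for l h
    proof -
      have "l \<in> carrier (G Mod N)" using subgroup.subset[OF subg] lh(1) by blast
      then obtain c where c: "c \<in> carrier G" "l = N #> c" unfolding carrier_FactGroup by blast
      obtain d where d: "d \<in> L" "h = N #> d" using lh(2) by blast
      have "d \<in> carrier G" using d(1) by simp
      from quotient_conj[OF N(1) c(1) this] show ?thesis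
        using L.inv_op_closed2[OF c(1) d(1)] unfolding c(2) d(2) by (metis imageI)
    qed
    obtain R where R: "subgroup R (G Mod N)" "p_sized p R" "?L \<union> ?g \<subseteq> R"
      using GN.H.p_sized_join[OF fin prime subL pL subg pg norm] by blast
    have "{N #> x, N #> g} \<subseteq> R" using R(3) x generate.incl[of "N #> g" "{N #> g}" "G Mod N"] by blast
    then have "generate (G Mod N) {N #> x, N #> g} \<subseteq> R" using R(1) by (rule GN.H.generate_subgroup_incl)
    moreover have "subgroup (generate (G Mod N) {N #> x, N #> g}) (G Mod N)"
      using gG xG by (intro GN.H.generate_is_subgroup) auto
    ultimately show "p_sized p (generate (G Mod N) {N #> x, N #> g})"
      using GN.H.p_sized_subgroup[OF fin prime R(1) _ _ R(2)] by blast
  qed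
qed

text \<open>The normal pro-p subgroup found above the set is also contained in it. The set is thus the greatest normal
pro-p subgroup, and in particular a greatest one exists, as the definition of \<open>p_core\<close> presupposes.\<close>

theorem p_core_eq_p_joint_set:
  shows "p_core G T p = p_joint_set" and "p_joint_set \<lhd> G" and "pro_p_subgroup p_joint_set G T p"
proof -
  obtain K where K: "K \<lhd> G" "pro_p_subgroup K G T p" "p_joint_set \<subseteq> K"
    using normal_pro_p_containing_p_joint_set by blast
  have eq: "K = p_joint_set" using normal_pro_p_subset_p_joint_set[OF K(1,2)] K(3) by blast
  show N: "p_joint_set \<lhd> G" and P: "pro_p_subgroup p_joint_set G T p" using K eq by blast+
  show "p_core G T p = p_joint_set"
    unfolding p_core_def
    by (rule Greatest_equality) (use N P normal_pro_p_subset_p_joint_set in auto)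
qed

text \<open>An open pro-p subgroup contains an open normal subgroup of \<open>G\<close>. That subgroup is pro-p, hence contained in
the p-core.\<close>

lemma virtually_pro_p_iff_open_p_joint_set:
  "virtually_pro_p G T p \<longleftrightarrow> openin T p_joint_set"
proof
  assume "virtually_pro_p G T p"
  then obtain H where H: "openin T H" "pro_p_subgroup H G T p" unfolding virtually_pro_p_def by blast
  have subH: "subgroup H G" using H(2) unfolding pro_p_subgroup_def by blast
  obtain N where N: "N \<lhd> G" "openin T N" "N \<subseteq> H"
    using open_normal_basis[OF H(1) subgroup.one_closed[OF subH]] by blast
  have subN: "subgroup N G" using N(1) by (rule normal_imp_subgroup)
  have "closedin T N" using subN N(2) by (rule open_subgroup_closed)
  moreover have "p_sized p ((\<lambda>x. M #> x) ` N)" if M: "M \<lhd> G" "openin T M" for M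
  proof -
    have "p_sized p ((\<lambda>x. M #> x) ` H)" using H(2) M unfolding pro_p_subgroup_iff[OF prime] by blast
    then show ?thesis
      unfolding p_sized_quotient_image_iff[OF prime M subN] p_sized_quotient_image_iff[OF prime M subH]
      using N(3) by blast
  qed
  ultimately have "pro_p_subgroup N G T p" using subN unfolding pro_p_subgroup_iff[OF prime] by blast
  then have "N \<subseteq> p_joint_set" using normal_pro_p_subset_p_joint_set[OF N(1)] by blast
  then show "openin T p_joint_set"
    using open_subgroup_supergroup[OF subN normal_imp_subgroup[OF p_core_eq_p_joint_set(2)] _ N(2)] by blast
next
  assume "openin T p_joint_set"
  then show "virtually_pro_p G T p" using p_core_eq_p_joint_set(3) unfolding virtually_pro_p_def by blast
qed

lemma virtually_pro_p_iff_finite_index: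
  "virtually_pro_p G T p \<longleftrightarrow> finite (rcosets p_joint_set)"
proof -
  have sub: "subgroup p_joint_set G" using p_core_eq_p_joint_set(2) by (rule normal_imp_subgroup)
  have "closedin T p_joint_set" using p_core_eq_p_joint_set(3) unfolding pro_p_subgroup_iff[OF prime] by simp
  then show ?thesis
    unfolding virtually_pro_p_iff_open_p_joint_set
    using closed_finite_index_open[OF sub] open_subgroup_finite_index[OF compact sub] by (intro iffI)
qed

end

section \<open>Haar measure and counting in finite quotients\<close>

locale haar_profinite_group = profinite_group_prime +
  fixes \<mu> :: "'a measure"
  assumes haar: "normalized_haar G T \<mu>"
begin

sublocale \<mu>: prob_space \<mu>
  using haar unfolding normalized_haar_def by blast

lemma sets_haar: "openin T U \<Longrightarrow> U \<in> sets \<mu>" "closedin T C \<Longrightarrow> C \<in> sets \<mu>"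
  and space_haar: "space \<mu> = carrier G"
proof -
  have sub: "{U. openin T U} \<subseteq> Pow (topspace T)" using openin_subset by blast
  have eq: "sets \<mu> = sets (sigma (topspace T) {U. openin T U})"
    using haar unfolding normalized_haar_def regular_borel_measure_def by blast
  then show sp: "space \<mu> = carrier G"
    using sets_eq_imp_space_eq[OF eq] sub by (simp add: topspace_eq_carrier)
  have op: "U \<in> sets \<mu>" if "openin T U" for U
    unfolding eq using sub that by (auto intro: sigma_sets.Basic)
  then show "openin T U \<Longrightarrow> U \<in> sets \<mu>" .
  have "space \<mu> - (topspace T - C) = C" if "closedin T C"
    using closedin_subset[OF that] sp by (auto simp: topspace_eq_carrier)
  then show "closedin T C \<Longrightarrow> C \<in> sets \<mu>"
    using op[of "topspace T - C"] by (metis closedin_def sets.compl_sets)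
qed

text \<open>The cosets of \<open>N\<close> are translates of each other, so they share the total mass 1 equally.\<close>

lemma measure_Union_cosets:
  assumes N: "N \<lhd> G" "openin T N" and A: "A \<subseteq> carrier (G Mod N)"
  shows "measure \<mu> (\<Union>A) = card A / card (carrier (G Mod N))"
proof -
  interpret N: normal N G by fact
  have coset: "C \<in> sets \<mu> \<and> measure \<mu> C = measure \<mu> N" if C: "C \<in> rcosets N" for C
  proof -
    obtain x where x: "x \<in> carrier G" "C = N #> x" using C by (auto simp: RCOSETS_def)
    then have "C = x <# N" using N.coset_eq by blast
    then have "emeasure \<mu> C = emeasure \<mu> N"
      using haar x(1) sets_haar(1)[OF N(2)] unfolding normalized_haar_def by blast
    moreover have "C \<in> sets \<mu>" using sets_haar(1) openin_r_coset[OF N(2) x(1)] x(2) by blast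
    ultimately show ?thesis by (simp add: measure_def)
  qed
  have un: "measure \<mu> (\<Union>B) = card B * measure \<mu> N" if B: "B \<subseteq> rcosets N" for B
  proof -
    have fin: "finite B"
      using B open_subgroup_finite_index[OF compact N.subgroup_axioms N(2)] by (rule finite_subset)
    have "measure \<mu> (\<Union>B) = (\<Sum>C\<in>B. measure \<mu> C)"
    proof (rule measure_Union'[OF fin])
      show "pairwise disjnt B" using rcos_disjoint[OF N.subgroup_axioms] B by (rule pairwise_subset)
      show "C \<in> fmeasurable \<mu>" if "C \<in> B" for C
        using coset B that \<mu>.fmeasurable_eq_sets by blast
    qed
    also have "\<dots> = (\<Sum>C\<in>B. measure \<mu> N)" using coset B by (intro sum.cong) auto
    finally show ?thesis by simp
  qed
  have "\<Union>(rcosets N) = space \<mu>" using rcosets_part_G[OF N.subgroup_axioms] space_haar by simp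
  then have "1 = card (rcosets N) * measure \<mu> N" using un[OF subset_refl] \<mu>.prob_space by simp
  then have "measure \<mu> N = 1 / card (rcosets N)"
    by (metis mult.commute mult_zero_left nonzero_eq_divide_eq zero_neq_one)
  then show ?thesis using un[of A] A unfolding finite_quotient(3)[OF N] by simp
qed

lemma measure_preimage_quotient:
  assumes "N \<lhd> G" "openin T N" "A \<subseteq> carrier (G Mod N)"
  shows "measure \<mu> {x \<in> carrier G. N #> x \<in> A} = card A / card (carrier (G Mod N))"
  using measure_Union_cosets[OF assms] preimage_quotient_eq_Union[OF assms(1,3)] by simp

lemma card_quotient_pos:
  assumes "N \<lhd> G" "openin T N"
  shows "card (carrier (G Mod N)) > 0"
proof -
  interpret GN: group_hom G "G Mod N" "\<lambda>x. N #> x" using finite_quotient(2)[OF assms] .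
  show ?thesis using finite_quotient(1)[OF assms] GN.H.one_closed card_gt_0_iff by blast
qed

text \<open>Multiplicativity of the index, read off from the two ways to compute \<open>\<mu> N\<close>.\<close>

lemma card_quotient_mult:
  assumes N: "N \<lhd> G" "openin T N" and J: "J \<lhd> G" "openin T J" and "J \<subseteq> N"
  shows "card (carrier (G Mod J)) = card ((\<lambda>x. J #> x) ` N) * card (carrier (G Mod N))"
proof -
  interpret N: normal N G by fact
  interpret J: normal J G by fact
  have sub: "(\<lambda>x. J #> x) ` N \<subseteq> carrier (G Mod J)" unfolding carrier_FactGroup by auto
  have "\<Union>((\<lambda>x. J #> x) ` N) = N"
  proof (intro equalityI subsetI)
    fix y assume "y \<in> \<Union>((\<lambda>x. J #> x) ` N)"
    then obtain x j where "x \<in> N" "j \<in> J" "y = j \<otimes> x" unfolding r_coset_def by blast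
    then show "y \<in> N" using \<open>J \<subseteq> N\<close> by auto
  next
    fix y assume y: "y \<in> N"
    then have "y \<in> J #> y" using rcos_self[OF _ J.subgroup_axioms] by simp
    then show "y \<in> \<Union>((\<lambda>x. J #> x) ` N)" using y by blast
  qed
  then have "measure \<mu> N = card ((\<lambda>x. J #> x) ` N) / card (carrier (G Mod J))"
    using measure_Union_cosets[OF J sub] by simp
  moreover have "{N} \<subseteq> carrier (G Mod N)"
    using N.subgroup_in_rcosets[OF is_group] unfolding finite_quotient(3)[OF N] by simp
  then have "measure \<mu> N = 1 / card (carrier (G Mod N))"
    using measure_Union_cosets[OF N, of "{N}"] by simp
  ultimately have "real (card (carrier (G Mod J))) = card ((\<lambda>x. J #> x) ` N) * card (carrier (G Mod N))"
    using card_quotient_pos[OF N] card_quotient_pos[OF J] by (simp add: field_simps)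
  then show ?thesis by (metis of_nat_eq_iff of_nat_mult)
qed

definition p_pairs :: "'a set \<Rightarrow> ('a set \<times> 'a set) set" where
  "p_pairs N = {(C, D). C \<in> carrier (G Mod N) \<and> D \<in> carrier (G Mod N) \<and>
     p_sized p (generate (G Mod N) {C, D})}"

lemma p_pairs_subset: "p_pairs N \<subseteq> carrier (G Mod N) \<times> carrier (G Mod N)"
  unfolding p_pairs_def by blast

section \<open>From positive probability to an open pro-p subgroup\<close>

text \<open>Write \<open>card (G Mod N) = p ^ a * m\<close> with \<open>m\<close> prime to \<open>p\<close>. The bound on the fraction of pairs that generate
a p-group gives \<open>c \<le> 1 / m\<close>, so some \<open>N\<close> attains the largest value of \<open>m\<close>. For every open normal \<open>M\<close>, passing
from \<open>N\<close> to \<open>M \<inter> N\<close> multiplies \<open>m\<close> by the part of the index prime to \<open>p\<close>, which must therefore be 1: the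
image of \<open>N\<close> modulo \<open>M \<inter> N\<close>, and with it the image modulo \<open>M\<close>, is a p-group.\<close>

theorem virtually_pro_p_if_many_p_pairs:
  assumes "c > 0" and many: "\<And>N. N \<lhd> G \<Longrightarrow> openin T N \<Longrightarrow>
    c * (real (card (carrier (G Mod N))))\<^sup>2 \<le> card (p_pairs N)"
  shows "virtually_pro_p G T p"
proof -
  define P where "P m \<longleftrightarrow> (\<exists>N a. N \<lhd> G \<and> openin T N \<and> card (carrier (G Mod N)) = p ^ a * m \<and> \<not> p dvd m)"
    for m
  have dec: "\<exists>a m. n = p ^ a * m \<and> \<not> p dvd m" if "n > 0" for n :: nat
  proof -
    have "\<not> is_unit p" using prime not_prime_unit by blast
    then show ?thesis using multiplicity_decompose'[of n p] that by (metis gr_implies_not0)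
  qed
  have ex: "P m" if "N \<lhd> G" "openin T N" "card (carrier (G Mod N)) = p ^ a * m" "\<not> p dvd m" for N a m
    unfolding P_def using that by blast
  have bound: "m \<le> nat \<lfloor>1 / c\<rfloor>" if Pm: "P m" for m
  proof -
    obtain N a where N: "N \<lhd> G" "openin T N" and m: "card (carrier (G Mod N)) = p ^ a * m" "\<not> p dvd m"
      using Pm unfolding P_def by blast
    interpret GN: group_hom G "G Mod N" "\<lambda>x. N #> x" using finite_quotient(2)[OF N] .
    let ?n = "card (carrier (G Mod N))"
    have "card (p_pairs N) * m \<le> ?n * ?n"
      using GN.H.card_p_generating_pairs_le[OF finite_quotient(1)[OF N] prime, of a m] m
      unfolding Coset.order_def p_pairs_def by simp
    then have "real (card (p_pairs N)) * m \<le> (real ?n)\<^sup>2"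
      unfolding power2_eq_square by (metis of_nat_le_iff of_nat_mult)
    moreover have "c * (real ?n)\<^sup>2 * m \<le> real (card (p_pairs N)) * m"
      using many[OF N] by (intro mult_right_mono) auto
    ultimately have "(c * m) * (real ?n)\<^sup>2 \<le> 1 * (real ?n)\<^sup>2" by (simp add: mult_ac)
    moreover have "(real ?n)\<^sup>2 > 0" using card_quotient_pos[OF N] by simp
    ultimately have "c * m \<le> 1" by (metis mult_le_cancel_right_pos)
    then have "real m \<le> 1 / c" using \<open>c > 0\<close> by (simp add: field_simps)
    then show ?thesis by (simp add: le_nat_floor)
  qed
  \<comment> \<open>The quotient by \<open>carrier G\<close> only serves to show that \<open>P\<close> is not empty.\<close>
  obtain a0 m0 where "card (carrier (G Mod carrier G)) = p ^ a0 * m0" "\<not> p dvd m0"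
    using dec[OF card_quotient_pos[OF carrier_open_normal]] by blast
  then have "P m0" using ex[OF carrier_open_normal] by blast
  then obtain m where m: "P m" "\<And>m'. P m' \<Longrightarrow> m' \<le> m"
    using ex_has_greatest_nat[of P m0 id "Suc (nat \<lfloor>1 / c\<rfloor>)"] bound
    by (auto simp: less_Suc_eq_le)
  then obtain N a where N: "N \<lhd> G" "openin T N" and Nm: "card (carrier (G Mod N)) = p ^ a * m" "\<not> p dvd m"
    unfolding P_def by blast
  have mpos: "m > 0" using card_quotient_pos[OF N] Nm(1) by simp
  have subN: "subgroup N G" using N(1) by (rule normal_imp_subgroup)
  have "p_sized p ((\<lambda>x. M #> x) ` N)" if M: "M \<lhd> G" "openin T M" for M
  proof -
    have J: "M \<inter> N \<lhd> G" "openin T (M \<inter> N)"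
      using normal_subgroup_intersect[OF M(1) N(1)] openin_Int[OF M(2) N(2)] by blast+
    let ?i = "card ((\<lambda>x. (M \<inter> N) #> x) ` N)"
    have mult: "card (carrier (G Mod (M \<inter> N))) = ?i * card (carrier (G Mod N))"
      by (rule card_quotient_mult[OF N J]) blast
    then have "?i > 0" using card_quotient_pos[OF J] by (metis gr0I mult_zero_left less_irrefl)
    then obtain b k where k: "?i = p ^ b * k" "\<not> p dvd k" using dec by blast
    have "card (carrier (G Mod (M \<inter> N))) = p ^ (b + a) * (k * m)"
      using mult k Nm by (simp add: power_add)
    moreover have "\<not> p dvd k * m" using k(2) Nm(2) prime prime_dvd_mult_iff by blast
    ultimately have "k * m \<le> m" using m(2) ex[OF J] by blast
    then have "k \<le> 1" using mpos by simp
    moreover have "k \<noteq> 0" using \<open>?i > 0\<close> k(1) by simp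
    ultimately have "?i = p ^ b" using k(1) by simp
    then have "p_sized p ((\<lambda>x. (M \<inter> N) #> x) ` N)" unfolding p_sized_def by blast
    then show ?thesis
      unfolding p_sized_quotient_image_iff[OF prime M subN] p_sized_quotient_image_iff[OF prime J subN]
      by blast
  qed
  moreover have "closedin T N" using subN N(2) by (rule open_subgroup_closed)
  ultimately have "pro_p_subgroup N G T p" using subN unfolding pro_p_subgroup_iff[OF prime] by blast
  then show ?thesis using N(2) unfolding virtually_pro_p_def by blast
qed

lemma closedin_Omega_at:
  assumes "g \<in> carrier G"
  shows "closedin T (Omega_at G T p g)"
proof -
  have "Omega_at G T p g = {x \<in> carrier G. \<forall>N. N \<lhd> G \<and> openin T N \<longrightarrow>
      N #> x \<in> {C \<in> carrier (G Mod N). p_sized p (generate (G Mod N) {C, N #> g})}}"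
    using Omega_at_iff[OF prime assms] by (auto simp: carrier_FactGroup)
  then show ?thesis by (simp only:) (rule closedin_all_quotients, blast)
qed

lemma Omega_at_one_p_element:
  assumes "x \<in> Omega_at G T p \<one>"
  shows "p_element G T p x"
proof (rule p_elementI)
  have x: "x \<in> carrier G" "\<And>N. N \<lhd> G \<Longrightarrow> openin T N \<Longrightarrow> p_sized p (generate (G Mod N) {N #> x, N #> \<one>})"
    using assms unfolding Omega_at_iff[OF prime one_closed] by blast+
  show "x \<in> carrier G" by (rule x)
  fix N assume N: "N \<lhd> G" "openin T N"
  show "\<exists>S. S \<subseteq> carrier (G Mod N) \<and> N #> x \<in> S \<and> p_sized p (generate (G Mod N) S)"
    using x(2)[OF N] x(1) by (intro exI[of _ "{N #> x, N #> \<one>}"]) (simp add: carrier_FactGroup)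
qed

text \<open>The function \<open>h \<mapsto> P_at G T \<mu> p h\<close> is positive on the p-elements, but without a uniform bound. It is bounded below
on each of countably many sets that cover the p-elements, and one of these has positive measure. The sets
\<open>E n\<close> are defined by the proportions in the finite quotients instead of by \<open>P_at\<close>: this makes them visibly closed,
and it replaces Fubini's theorem by a finite double count.\<close>

theorem virtually_pro_p_if_p_positive:
  assumes pos: "p_positive G T \<mu> p"
  shows "virtually_pro_p G T p"
proof -
  let ?O = "\<lambda>N. N \<lhd> G \<and> openin T N"
  define f where "f N C = card {D \<in> carrier (G Mod N). p_sized p (generate (G Mod N) {C, D})}" for N C
  define B where "B n N = {C \<in> carrier (G Mod N). card (carrier (G Mod N)) \<le> Suc n * f N C}" for n N
  define E where "E n = {x \<in> carrier G. \<forall>N. ?O N \<longrightarrow> N #> x \<in> B n N}" for n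
  have B: "B n N \<subseteq> carrier (G Mod N)" for n N unfolding B_def by blast
  have E: "E n \<in> sets \<mu>" for n
    unfolding E_def by (rule sets_haar(2), rule closedin_all_quotients) (rule B)
  \<comment> \<open>Projecting \<open>Omega_at\<close> to the quotient can only increase its measure.\<close>
  have f: "P_at G T \<mu> p h * card (carrier (G Mod N)) \<le> f N (N #> h)"
    if h: "h \<in> carrier G" and N: "N \<lhd> G" "openin T N" for h N
  proof -
    let ?D = "{D \<in> carrier (G Mod N). p_sized p (generate (G Mod N) {N #> h, D})}"
    have "Omega_at G T p h \<subseteq> {x \<in> carrier G. N #> x \<in> ?D}"
      using Omega_at_iff[OF prime h] N by (auto simp: carrier_FactGroup insert_commute)
    moreover have "{x \<in> carrier G. N #> x \<in> ?D} \<in> sets \<mu>"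
      by (rule sets_haar(1), rule clopen_preimage_quotient(1)[OF N]) blast
    ultimately have "P_at G T \<mu> p h \<le> measure \<mu> {x \<in> carrier G. N #> x \<in> ?D}"
      unfolding P_at_def by (rule \<mu>.finite_measure_mono)
    also have "\<dots> = card ?D / card (carrier (G Mod N))"
      by (rule measure_preimage_quotient[OF N]) blast
    finally show ?thesis using card_quotient_pos[OF N] unfolding f_def by (simp add: pos_le_divide_eq)
  qed
  \<comment> \<open>\<open>Omega_at G T p \<one>\<close> is the set of p-elements.\<close>
  have cover: "Omega_at G T p \<one> \<subseteq> (\<Union>n. E n)"
  proof
    fix h assume "h \<in> Omega_at G T p \<one>"
    then have h: "p_element G T p h" by (rule Omega_at_one_p_element)
    have hG: "h \<in> carrier G" using h unfolding p_element_def by blast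
    have "P_at G T \<mu> p h > 0" using pos h unfolding p_positive_def p_elements_def by blast
    then obtain n where n: "inverse (real (Suc n)) < P_at G T \<mu> p h" using reals_Archimedean by blast
    have "N #> h \<in> B n N" if N: "N \<lhd> G" "openin T N" for N
    proof -
      have "inverse (real (Suc n)) * card (carrier (G Mod N)) \<le> P_at G T \<mu> p h * card (carrier (G Mod N))"
        using n by (intro mult_right_mono) auto
      also have "\<dots> \<le> f N (N #> h)" using f[OF hG N] .
      finally have "real (card (carrier (G Mod N))) \<le> real (Suc n) * real (f N (N #> h))"
        by (simp add: field_simps)
      then have "card (carrier (G Mod N)) \<le> Suc n * f N (N #> h)" by (metis of_nat_le_iff of_nat_mult)
      then show ?thesis unfolding B_def using hG by (auto simp: carrier_FactGroup)
    qed
    then have "h \<in> E n" unfolding E_def using hG by blast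
    then show "h \<in> (\<Union>n. E n)" by blast
  qed
  have "0 < measure \<mu> (Omega_at G T p \<one>)"
    using pos one_p_element unfolding p_positive_def P_at_def p_elements_def by blast
  also have "\<dots> \<le> measure \<mu> (\<Union>n. E n)"
    using cover E by (intro \<mu>.finite_measure_mono) auto
  finally have "emeasure \<mu> (\<Union>n. E n) \<noteq> 0" by (auto simp: measure_def)
  then obtain n where n: "emeasure \<mu> (E n) \<noteq> 0" using emeasure_UN_eq_0[of \<mu> E] E by blast
  then have npos: "measure \<mu> (E n) > 0" by (simp add: \<mu>.emeasure_eq_measure zero_less_measure_iff)
  show ?thesis
  proof (rule virtually_pro_p_if_many_p_pairs)
    show "measure \<mu> (E n) / Suc n > 0" using npos by simp
    fix N assume N: "N \<lhd> G" "openin T N"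
    let ?k = "card (carrier (G Mod N))"
    have fin: "finite (carrier (G Mod N))" using finite_quotient(1)[OF N] .
    have "measure \<mu> (E n) \<le> measure \<mu> {x \<in> carrier G. N #> x \<in> B n N}"
      by (rule \<mu>.finite_measure_mono)
        (use N E_def sets_haar(1) clopen_preimage_quotient(1)[OF N B] in auto)
    also have "\<dots> = card (B n N) / ?k" by (rule measure_preimage_quotient[OF N B])
    finally have "measure \<mu> (E n) * ?k \<le> card (B n N)"
      using card_quotient_pos[OF N] by (simp add: pos_le_divide_eq)
    then have "measure \<mu> (E n) * ?k * ?k \<le> real (card (B n N)) * ?k" by (intro mult_right_mono) auto
    also have "\<dots> = (\<Sum>C\<in>B n N. real ?k)" by simp
    also have "\<dots> \<le> (\<Sum>C\<in>B n N. real (Suc n * f N C))"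
      by (intro sum_mono) (simp only: B_def of_nat_le_iff mem_Collect_eq)
    also have "\<dots> \<le> (\<Sum>C\<in>carrier (G Mod N). real (Suc n * f N C))"
      using fin B by (intro sum_mono2) auto
    also have "\<dots> = real (Suc n) * real (\<Sum>C\<in>carrier (G Mod N). f N C)"
      by (simp only: of_nat_mult of_nat_sum sum_distrib_left)
    also have "(\<Sum>C\<in>carrier (G Mod N). f N C) = card (p_pairs N)"
    proof -
      have "p_pairs N = (SIGMA C:carrier (G Mod N). {D \<in> carrier (G Mod N). p_sized p (generate (G Mod N) {C, D})})"
        unfolding p_pairs_def by auto
      then show ?thesis unfolding f_def using fin by (simp add: card_SigmaI)
    qed
    finally have "measure \<mu> (E n) * ?k * ?k \<le> real (Suc n) * real (card (p_pairs N))" .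
    then show "measure \<mu> (E n) / Suc n * (real ?k)\<^sup>2 \<le> card (p_pairs N)"
      by (simp add: power2_eq_square field_simps)
  qed
qed

section \<open>From an open pro-p subgroup to positive probability\<close>

lemma measure_p_joint_set:
  assumes "virtually_pro_p G T p"
  shows "measure \<mu> p_joint_set = inverse_index G p_joint_set" "inverse_index G p_joint_set > 0"
proof -
  have N: "p_joint_set \<lhd> G" "openin T p_joint_set"
    using assms virtually_pro_p_iff_open_p_joint_set p_core_eq_p_joint_set(2) by blast+
  have "{p_joint_set} \<subseteq> carrier (G Mod p_joint_set)"
    using subgroup.subgroup_in_rcosets[OF normal_imp_subgroup[OF N(1)] is_group]
    unfolding finite_quotient(3)[OF N] by simp
  then show "measure \<mu> p_joint_set = inverse_index G p_joint_set"
    using measure_Union_cosets[OF N, of "{p_joint_set}"]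
    unfolding inverse_index_def finite_quotient(3)[OF N] by (simp add: inverse_eq_divide)
  show "inverse_index G p_joint_set > 0"
    using card_quotient_pos[OF N] unfolding inverse_index_def finite_quotient(3)[OF N] by simp
qed

lemma p_uniformly_positive_if_virtually_pro_p:
  assumes "virtually_pro_p G T p"
  shows "p_uniformly_positive G T \<mu> p"
proof -
  have pos: "measure \<mu> p_joint_set > 0" using measure_p_joint_set[OF assms] by simp
  \<comment> \<open>Halving turns the weak lower bound into the required strict one.\<close>
  have "measure \<mu> p_joint_set / 2 < P_at G T \<mu> p g" if g: "g \<in> p_elements G T p" for g
  proof -
    have gG: "g \<in> carrier G" using g unfolding p_elements_def p_element_def by blast
    have "measure \<mu> p_joint_set \<le> P_at G T \<mu> p g"
      unfolding P_at_def using g sets_haar(2)[OF closedin_Omega_at[OF gG]]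
      by (intro \<mu>.finite_measure_mono) (auto simp: p_joint_set_def)
    then show ?thesis using pos by simp
  qed
  moreover have "measure \<mu> p_joint_set / 2 > 0" using pos by simp
  ultimately show "p_uniformly_positive G T \<mu> p" unfolding p_uniformly_positive_def by blast
qed

section \<open>Pairs of elements\<close>

lemma preimage_p_pairs:
  assumes N: "N \<lhd> G" "openin T N"
  shows "{(x, y). x \<in> carrier G \<and> y \<in> carrier G \<and> (N #> x, N #> y) \<in> p_pairs N}
    = (\<Union>(C, D)\<in>p_pairs N. C \<times> D)"
proof -
  have key: "x \<in> C \<longleftrightarrow> x \<in> carrier G \<and> N #> x = C" if C: "C \<in> carrier (G Mod N)" for x C
    using preimage_quotient_eq_Union[OF N(1), of "{C}"] C by auto
  have "(x, y) \<in> (\<Union>(C, D)\<in>p_pairs N. C \<times> D) \<longleftrightarrow>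
      x \<in> carrier G \<and> y \<in> carrier G \<and> (N #> x, N #> y) \<in> p_pairs N" for x y
  proof -
    have "(x, y) \<in> (\<Union>(C, D)\<in>p_pairs N. C \<times> D) \<longleftrightarrow> (\<exists>C D. (C, D) \<in> p_pairs N \<and> x \<in> C \<and> y \<in> D)"
      by (simp add: Bex_def)
    also have "\<dots> \<longleftrightarrow> (\<exists>C D. (C, D) \<in> p_pairs N \<and> (x \<in> carrier G \<and> N #> x = C) \<and> (y \<in> carrier G \<and> N #> y = D))"
      by (intro ex_cong1 conj_cong refl) (use key p_pairs_subset in blast)+
    also have "\<dots> \<longleftrightarrow> x \<in> carrier G \<and> y \<in> carrier G \<and> (N #> x, N #> y) \<in> p_pairs N" by blast
    finally show ?thesis .
  qed
  then show ?thesis by (simp only: set_eq_iff split_paired_All mem_Collect_eq case_prod_conv) simp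
qed

lemma p_pair_rectangles:
  assumes N: "N \<lhd> G" "openin T N" and CD: "(C, D) \<in> p_pairs N"
  shows "closedin (prod_topology T T) (C \<times> D)" "C \<in> sets \<mu>" "D \<in> sets \<mu>"
    "measure \<mu> C = 1 / card (carrier (G Mod N))" "measure \<mu> D = 1 / card (carrier (G Mod N))"
proof -
  have c: "closedin T C \<and> measure \<mu> C = 1 / card (carrier (G Mod N))" if C: "C \<in> carrier (G Mod N)" for C
    using clopen_preimage_quotient(2)[OF N, of "{C}"] preimage_quotient_eq_Union[OF N(1), of "{C}"]
      measure_Union_cosets[OF N, of "{C}"] C by simp
  have CD': "C \<in> carrier (G Mod N)" "D \<in> carrier (G Mod N)" using CD p_pairs_subset by blast+
  show "closedin (prod_topology T T) (C \<times> D)" using c CD' by (simp add: closedin_prod_Times_iff)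
  show "C \<in> sets \<mu>" "D \<in> sets \<mu>" using c CD' sets_haar(2) by blast+
  show "measure \<mu> C = 1 / card (carrier (G Mod N))" "measure \<mu> D = 1 / card (carrier (G Mod N))"
    using c CD' by blast+
qed

context
  fixes \<nu> :: "('a \<times> 'a) measure"
  assumes nu: "regular_product T \<mu> \<nu>"
begin

lemma product_measure:
  assumes "A \<in> sets \<mu>" "B \<in> sets \<mu>"
  shows "measure \<nu> (A \<times> B) = measure \<mu> A * measure \<mu> B"
proof -
  have "emeasure \<nu> (A \<times> B) = emeasure \<mu> A * emeasure \<mu> B"
    using nu assms unfolding regular_product_def by blast
  then show ?thesis by (simp add: measure_def enn2real_mult)
qed

lemma sets_product_closed: "closedin (prod_topology T T) C \<Longrightarrow> C \<in> sets \<nu>"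
  and finite_product: "finite_measure \<nu>"
proof -
  let ?P = "prod_topology T T"
  have sub: "{U. openin ?P U} \<subseteq> Pow (topspace ?P)" using openin_subset by blast
  have eq: "sets \<nu> = sets (sigma (topspace ?P) {U. openin ?P U})"
    using nu unfolding regular_product_def regular_borel_measure_def by blast
  then have sp: "space \<nu> = topspace ?P"
    using sets_eq_imp_space_eq[OF eq] sub by simp
  have op: "U \<in> sets \<nu>" if "openin ?P U" for U
    unfolding eq using sub that by (auto intro: sigma_sets.Basic)
  have "space \<nu> - (topspace ?P - C) = C" if "closedin ?P C"
    using closedin_subset[OF that] sp by auto
  then show "closedin ?P C \<Longrightarrow> C \<in> sets \<nu>"
    using op[of "topspace ?P - C"] by (metis closedin_def sets.compl_sets)
  have "space \<nu> = space \<mu> \<times> space \<mu>" unfolding sp space_haar by (simp add: topspace_eq_carrier)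
  then have "emeasure \<nu> (space \<nu>) = emeasure \<mu> (space \<mu>) * emeasure \<mu> (space \<mu>)"
    using nu unfolding regular_product_def by auto
  then show "finite_measure \<nu>" by (intro finite_measureI) (simp add: \<mu>.emeasure_space_1)
qed

abbreviation pro_p_pairs :: "('a \<times> 'a) set" where
  "pro_p_pairs \<equiv> {(x, y). x \<in> carrier G \<and> y \<in> carrier G \<and>
     pro_p_subgroup (top_generate G T {x, y}) G T p}"

text \<open>Presents the set as an intersection of finite unions of clopen rectangles. It is therefore closed, and \<open>\<nu>\<close> is
evaluated only on rectangles, where it is a product.\<close>

lemma pro_p_pairs_eq:
  "pro_p_pairs = (\<Inter>N\<in>{N. N \<lhd> G \<and> openin T N}. \<Union>(C, D)\<in>p_pairs N. C \<times> D)" (is "_ = (\<Inter>N\<in>?O. ?R N)")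
proof -
  have "(x, y) \<in> pro_p_pairs \<longleftrightarrow> (\<forall>N\<in>?O. (x, y) \<in> ?R N)" for x y
  proof -
    have R: "(x, y) \<in> ?R N \<longleftrightarrow> x \<in> carrier G \<and> y \<in> carrier G \<and> (N #> x, N #> y) \<in> p_pairs N" if "N \<in> ?O" for N
      using preimage_p_pairs[of N] that by blast
    have iff: "pro_p_subgroup (top_generate G T {x, y}) G T p \<longleftrightarrow> (\<forall>N\<in>?O. (N #> x, N #> y) \<in> p_pairs N)"
      if "x \<in> carrier G" "y \<in> carrier G"
      using pro_p_top_generate_iff[OF prime, of "{x, y}"] that unfolding p_pairs_def
      by (simp add: carrier_FactGroup)
    have "carrier G \<in> ?O" using carrier_open_normal by blast
    then show ?thesis using R iff by (metis (mono_tags, lifting) case_prodI case_prodD mem_Collect_eq)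
  qed
  then have *: "z \<in> pro_p_pairs \<longleftrightarrow> z \<in> (\<Inter>N\<in>?O. ?R N)" for z
    by (cases z) (simp only: INT_iff)
  show ?thesis by (rule Set.set_eqI) (rule *)
qed

lemma p_pairs_union:
  assumes N: "N \<lhd> G" "openin T N"
  shows "closedin (prod_topology T T) (\<Union>(C, D)\<in>p_pairs N. C \<times> D)"
    "measure \<nu> (\<Union>(C, D)\<in>p_pairs N. C \<times> D) * (real (card (carrier (G Mod N))))\<^sup>2 \<le> card (p_pairs N)"
proof -
  let ?k = "card (carrier (G Mod N))"
  have fin: "finite (p_pairs N)"
    using finite_subset[OF p_pairs_subset] finite_quotient(1)[OF N] by simp
  have cl: "closedin (prod_topology T T) (case z of (C, D) \<Rightarrow> C \<times> D)" if "z \<in> p_pairs N" for z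
    using p_pair_rectangles(1)[OF N] that by (cases z) auto
  show "closedin (prod_topology T T) (\<Union>(C, D)\<in>p_pairs N. C \<times> D)"
    using fin cl by (intro closedin_Union) auto
  have "measure \<nu> (\<Union>(C, D)\<in>p_pairs N. C \<times> D) \<le> (\<Sum>z\<in>p_pairs N. measure \<nu> (case z of (C, D) \<Rightarrow> C \<times> D))"
    using fin cl sets_product_closed by (intro measure_UNION_le) auto
  also have "\<dots> = (\<Sum>z\<in>p_pairs N. 1 / (real ?k)\<^sup>2)"
  proof (rule sum.cong)
    fix z assume z: "z \<in> p_pairs N"
    obtain C D where "z = (C, D)" by (cases z)
    then show "measure \<nu> (case z of (C, D) \<Rightarrow> C \<times> D) = 1 / (real ?k)\<^sup>2"
      using p_pair_rectangles[OF N] z product_measure by (simp add: power2_eq_square)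
  qed simp
  finally show "measure \<nu> (\<Union>(C, D)\<in>p_pairs N. C \<times> D) * (real ?k)\<^sup>2 \<le> card (p_pairs N)"
    using card_quotient_pos[OF N] by (simp add: field_simps)
qed

lemma closedin_pro_p_pairs: "closedin (prod_topology T T) pro_p_pairs"
  unfolding pro_p_pairs_eq using carrier_open_normal p_pairs_union(1) by (intro closedin_INT) auto

lemma virtually_pro_p_if_P_pair_pos:
  assumes pos: "P_pair G T \<nu> p > 0"
  shows "virtually_pro_p G T p"
proof (rule virtually_pro_p_if_many_p_pairs[OF pos])
  fix N assume N: "N \<lhd> G" "openin T N"
  interpret \<nu>: finite_measure \<nu> by (rule finite_product)
  have "P_pair G T \<nu> p \<le> measure \<nu> (\<Union>(C, D)\<in>p_pairs N. C \<times> D)"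
    unfolding P_pair_def
  proof (rule \<nu>.finite_measure_mono)
    show "pro_p_pairs \<subseteq> (\<Union>(C, D)\<in>p_pairs N. C \<times> D)" unfolding pro_p_pairs_eq using N by blast
    show "(\<Union>(C, D)\<in>p_pairs N. C \<times> D) \<in> sets \<nu>" using sets_product_closed p_pairs_union(1)[OF N] by blast
  qed
  then have "P_pair G T \<nu> p * (real (card (carrier (G Mod N))))\<^sup>2
      \<le> measure \<nu> (\<Union>(C, D)\<in>p_pairs N. C \<times> D) * (real (card (carrier (G Mod N))))\<^sup>2"
    by (intro mult_right_mono) auto
  also have "\<dots> \<le> card (p_pairs N)" by (rule p_pairs_union(2)[OF N])
  finally show "P_pair G T \<nu> p * (real (card (carrier (G Mod N))))\<^sup>2 \<le> card (p_pairs N)" .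
qed

lemma P_pair_pos_if_virtually_pro_p:
  assumes v: "virtually_pro_p G T p"
  shows "P_pair G T \<nu> p > 0"
proof -
  interpret \<nu>: finite_measure \<nu> by (rule finite_product)
  have X: "p_joint_set \<in> sets \<mu>" using v virtually_pro_p_iff_open_p_joint_set sets_haar(1) by blast
  have mpos: "measure \<mu> p_joint_set > 0" using measure_p_joint_set[OF v] by simp
  have sub: "p_joint_set \<times> p_joint_set \<subseteq> pro_p_pairs"
  proof clarify
    fix x y assume x: "x \<in> p_joint_set" and y: "y \<in> p_joint_set"
    have "y \<in> p_elements G T p" using p_joint_set_p_element[OF y] unfolding p_elements_def by blast
    then have "x \<in> Omega_at G T p y" using x unfolding p_joint_set_def by blast
    then show "x \<in> carrier G \<and> y \<in> carrier G \<and> pro_p_subgroup (top_generate G T {x, y}) G T p"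
      using y p_joint_set_carrier unfolding Omega_at_def by blast
  qed
  have "0 < measure \<nu> (p_joint_set \<times> p_joint_set)" using mpos unfolding product_measure[OF X X] by simp
  also have "\<dots> \<le> P_pair G T \<nu> p"
    unfolding P_pair_def using sub sets_product_closed[OF closedin_pro_p_pairs] by (rule \<nu>.finite_measure_mono)
  finally show ?thesis .
qed

end

end

theorem theorem6:
  fixes G :: "('a, 'b) monoid_scheme" and T :: "'a topology" and p :: nat
    and \<mu> :: "'a measure" and \<nu> :: "('a \<times> 'a) measure"
  assumes "profinite_group G T"
    and "Factorial_Ring.prime p"
    and "normalized_haar G T \<mu>"
    and "regular_product T \<mu> \<nu>"
  shows "(p_positive G T \<mu> p \<longleftrightarrow> p_uniformly_positive G T \<mu> p) \<and>
    (p_uniformly_positive G T \<mu> p \<longleftrightarrow> P_pair G T \<nu> p > 0) \<and>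
    (P_pair G T \<nu> p > 0 \<longleftrightarrow> virtually_pro_p G T p) \<and>
    (virtually_pro_p G T p \<longleftrightarrow>
      measure \<mu> (\<Inter>g\<in>p_elements G T p. Omega_at G T p g) = inverse_index G (p_core G T p) \<and>
      inverse_index G (p_core G T p) > 0)"
proof -
  interpret haar_profinite_group G T p \<mu>
    using assms(1-3)
    by (simp add: haar_profinite_group_def haar_profinite_group_axioms_def profinite_group_prime_def
        profinite_group_prime_axioms_def)
  have "p_positive G T \<mu> p" if "p_uniformly_positive G T \<mu> p"
    using that unfolding p_uniformly_positive_def p_positive_def by (meson less_trans)
  then have positive: "p_positive G T \<mu> p \<longleftrightarrow> virtually_pro_p G T p"
    and uniform: "p_uniformly_positive G T \<mu> p \<longleftrightarrow> virtually_pro_p G T p"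
    using virtually_pro_p_if_p_positive p_uniformly_positive_if_virtually_pro_p by blast+
  have pair: "P_pair G T \<nu> p > 0 \<longleftrightarrow> virtually_pro_p G T p"
    using virtually_pro_p_if_P_pair_pos[OF assms(4)] P_pair_pos_if_virtually_pro_p[OF assms(4)] by (rule iffI)
  have "virtually_pro_p G T p" if "inverse_index G p_joint_set > 0"
    using that card.infinite unfolding virtually_pro_p_iff_finite_index inverse_index_def by fastforce
  then have joint: "measure \<mu> p_joint_set = inverse_index G p_joint_set \<and> inverse_index G p_joint_set > 0
      \<longleftrightarrow> virtually_pro_p G T p"
    using measure_p_joint_set by blast
  show ?thesis
    unfolding p_joint_set_def[symmetric] p_core_eq_p_joint_set(1) joint positive uniform pair by simp
qed

end
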